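(* Let $\mathcal Q=\mathrm{LP}_l(A,A^* )$ be a canonical lifted-product code of distance $d$ with canonical logical basis $\{\bar Z_{i,j,m},\bar X_{i,j,m}\}_{i,j\in[r_A],\,m\in[l]}$ (chosen with $G_B^{*0}=G_A^0$). Then $$\mathfrak S_{\mathrm{seed}}=\{\bar Z_{i,0,0}\}_{i\in[r_A]}$$ is a complete set of seed logical operators for the canonical logical basis: given any surgery gadgets $\mathcal S^{(s)}[\mathcal G^{(s)};(\Phi_1^{(s)},\Phi_0^{(s)})]$, one for each $\bar L^{(s)}\in\mathfrak S_{\mathrm{seed}}$, measuring $\bar L^{(s)}$ and satisfying the surgery gadget desiderata, for every canonical basis operator $\bar L\in\{\bar Z_{i,j,m}\}\cup\{\bar X_{i,j,m}\}$ there exist a seed operator $\bar L^{(s)}$ and a transforming map $(T_1,T_0)$ (a linear map $T_1$ on the symplectic space of $n$-qubit Paulis and a linear map $T_0$ on the total check space $\mathcal Q_0\oplus\mathcal Q_2$) such that $\bar L=T_1\bar L^{(s)}$ and the rewired surgery gadget $\mathcal S[\mathcal G^{(s)};(T_1\Phi_1^{(s)},T_0\Phi_0^{(s)})]$ fault-tolerantly measures $\bar L$.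
   Context: $R=\mathbb F_2[x]/(x^l+1)$, $[n]=\{0,\dots,n-1\}$; $\bar f(x)=f(x^{-1})$ on $R$, $A^*=\bar A^T$. For $A\in R^{m_A\times n_A}$, $\mathrm{LP}_l(A,A^* )$ is the CSS code whose parity checks are the binarizations of $H_X=(A\otimes I_{n_A},\ I_{m_A}\otimes A^* )$ and $H_Z=(I_{n_A}\otimes A,\ A^*\otimes I_{m_A})$, with qubits indexed by coefficients of $R^{n_A}\otimes_R R^{n_A}$ (left block) $\oplus\ R^{m_A}\otimes_R R^{m_A}$ (right block). With $r_A=n_A-m_A$, it is canonical if, after a coordinate permutation of $R^{n_A}$ (assumed done), there is $G_A^0\in R^{r_A\times m_A}$ such that, with $u^{(i)}$ the $i$-th row of $(I_{r_A},G_A^0)$ and $e^{(i)}$ the $i$-th unit vector, the left-block vectors $\mathrm{supp}\,\bar Z_{i,j,m}=x^mu^{(i)}\otimes_Re^{(j)}$ and $\mathrm{supp}\,\bar X_{i,j,m}=x^me^{(i)}\otimes_Ru^{(j)}$ are members of a $Z$-type, resp. $X$-type, logical basis. These operators form the canonical logical basis. Logical Paulis are identified with symplectic vectors in $\mathbb F_2^{2n}$ ($X$-part on top). Graph-surgery gadget $\mathcal S[\mathcal G;(\Phi_1,\Phi_0)]$ on a CSS code $\mathcal Q_2\xrightarrow{H_Z^T}\mathcal Q_1\xrightarrow{H_X}\mathcal Q_0$: $\mathcal G$ is a connected graph with vertices $\mathcal V$, edges $\mathcal E$ and a cycle generating set $\mathcal C$, giving a sequence $\mathbb F_2[\mathcal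 V]\xrightarrow{\partial_1}\mathbb F_2[\mathcal E]\xrightarrow{\partial_0}\mathbb F_2[\mathcal C]$ exact at $\mathbb F_2[\mathcal E]$ ($\partial_1$ the edge-vertex, $\partial_0$ the cycle-edge incidence matrix). $\Phi_1=\binom{\Phi_1^{(X)}}{\Phi_1^{(Z)}}:\mathbb F_2[\mathcal V]\to\mathcal Q_1\oplus\mathcal Q_1$ and $\Phi_0=\binom{\Phi_0^{(Z)}}{\Phi_0^{(X)}}:\mathbb F_2[\mathcal E]\to\mathcal Q_0\oplus\mathcal Q_2$ satisfy the commutation conditions $(\Phi_1^{(X)})^T\Phi_1^{(Z)}=(\Phi_1^{(Z)})^T\Phi_1^{(X)}$, $H_Z\Phi_1^{(X)}=\Phi_0^{(X)}\partial_1$, $H_X\Phi_1^{(Z)}=\Phi_0^{(Z)}\partial_1$. The merged code on qubits $\mathcal Q_1\sqcup\mathcal E$ has stabilizer generators: each $X$-check of $\mathcal Q$ times $X$ on $\mathcal E$ along its row of $\Phi_0^{(Z)}$; each $Z$-check of $\mathcal Q$ times $X$ on $\mathcal E$ along its row of $\Phi_0^{(X)}$; for each $v\in\mathcal V$, $X(\Phi_1^{(X)}v)Z(\Phi_1^{(Z)}v)$ on data times $Z(\partial_1v)$ on $\mathcal E$; for each cycle, $X$ on its edges. The measured operators are $\Phi_1(\ker\partial_1)$. Soundness: $\partial_1$ is $(t,\rho)$-sound if $|\partial_1u|\ge\rho\min_{v\in\ker\partial_1}|u+v|$ for all $u$ with $|\partial_1u|<t$ (Hamming weights). Surgery gadget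 desiderata for measuring $\bar L$: (i) the commutation conditions hold, $\Phi_1(\ker\partial_1)=\{0,\bar L\}$, and the connectivity map is elementary: $\Phi_1^{(X)}$ and $\Phi_1^{(Z)}$ are $0/1$ restriction maps onto supports of physical representatives, with every row of weight at most 1; (ii) $\partial_1$ is $(d,\rho_d)$-sound with $\rho_d\ge\max(\omega_{\rm col}(\Phi_1^{(X)}),\omega_{\rm col}(\Phi_1^{(Z)}))$, $\omega_{\rm col}$ being maximum column weight; (iii) the merged code's degree (maximum check weight or number of $X$- or $Z$-type checks on a qubit) exceeds that of $\mathcal Q$ by at most a constant $\delta$. "Fault-tolerantly measures $\bar L$": the gadget satisfies the commutation conditions, $\Phi_1(\ker\partial_1)=\{0,\bar L\}$, and the merged code has distance at least $d$. *)

theory Defs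
  imports
    "HOL-Library.Z2"
    "HOL-Library.Function_Algebras"
    "HOL-Library.Extended_Nat"
    "HOL-Computational_Algebra.Polynomial"
begin

section \<open>Vectors and matrices over finite index sets\<close>

text \<open>
  The space \<open>F\<^sub>2[S]\<close> consists of the functions that vanish outside \<open>S\<close>, and a matrix with rows
  \<open>I\<close> and columns \<open>J\<close> is a function that vanishes outside \<open>I \<times> J\<close>.  Hence equality of vectors and
  matrices is equality of functions, and a product only needs the (finite) index set that is
  summed over.
\<close>

definition vec_on :: "'a set \<Rightarrow> ('a \<Rightarrow> bit) set" where
  "vec_on S = {v. \<forall>i. i \<notin> S \<longrightarrow> v i = 0}"

definition mat_on :: "'r set \<Rightarrow> 'c set \<Rightarrow> ('r \<Rightarrow> 'c \<Rightarrow> 'k::zero) set" where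
  "mat_on I J = {M. \<forall>i j. i \<notin> I \<or> j \<notin> J \<longrightarrow> M i j = 0}"

definition mat_vec :: "'c set \<Rightarrow> ('r \<Rightarrow> 'c \<Rightarrow> bit) \<Rightarrow> ('c \<Rightarrow> bit) \<Rightarrow> 'r \<Rightarrow> bit" where
  "mat_vec J M v = (\<lambda>i. \<Sum>j\<in>J. M i j * v j)"

definition mat_mul :: "'c set \<Rightarrow> ('r \<Rightarrow> 'c \<Rightarrow> bit) \<Rightarrow> ('c \<Rightarrow> 'd \<Rightarrow> bit) \<Rightarrow> 'r \<Rightarrow> 'd \<Rightarrow> bit" where
  "mat_mul J M N = (\<lambda>i k. \<Sum>j\<in>J. M i j * N j k)"

definition transp :: "('r \<Rightarrow> 'c \<Rightarrow> 'k) \<Rightarrow> 'c \<Rightarrow> 'r \<Rightarrow> 'k" where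
  "transp M = (\<lambda>i j. M j i)"

definition ker_on :: "'c set \<Rightarrow> ('r \<Rightarrow> 'c \<Rightarrow> bit) \<Rightarrow> ('c \<Rightarrow> bit) set" where
  "ker_on J M = {v \<in> vec_on J. mat_vec J M v = 0}"

definition im_on :: "'c set \<Rightarrow> ('r \<Rightarrow> 'c \<Rightarrow> bit) \<Rightarrow> ('r \<Rightarrow> bit) set" where
  "im_on J M = mat_vec J M ` vec_on J"

definition hamming :: "('a \<Rightarrow> bit) \<Rightarrow> nat" where
  "hamming v = card {i. v i \<noteq> 0}"

definition max_col_weight :: "'c set \<Rightarrow> ('r \<Rightarrow> 'c \<Rightarrow> bit) \<Rightarrow> nat" where
  "max_col_weight J M = Max ((\<lambda>j. hamming (\<lambda>i. M i j)) ` J)"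

text \<open>\<open>B\<close> is a system of representatives of a basis of \<open>K / S\<close>; the coefficients of a linear
  combination over \<open>F\<^sub>2\<close> are given by the subset \<open>C\<close>.\<close>

definition basis_modulo :: "('a \<Rightarrow> bit) set \<Rightarrow> ('a \<Rightarrow> bit) set \<Rightarrow> ('a \<Rightarrow> bit) set \<Rightarrow> bool" where
  "basis_modulo K S B \<longleftrightarrow>
     B \<subseteq> K \<and> (\<forall>v\<in>K. \<exists>!C. C \<subseteq> B \<and> v - (\<Sum>u\<in>C. u) \<in> S)"

section \<open>Stabilizer codes\<close>

text \<open>A Pauli operator is a symplectic vector on \<open>'q + 'q\<close>: \<open>Inl\<close> is the X-part and
  \<open>Inr\<close> the Z-part.\<close>

type_synonym 'q pauli = "'q + 'q \<Rightarrow> bit"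

definition x_pauli :: "('q \<Rightarrow> bit) \<Rightarrow> 'q pauli" where
  "x_pauli v = case_sum v (\<lambda>_. 0)"

definition z_pauli :: "('q \<Rightarrow> bit) \<Rightarrow> 'q pauli" where
  "z_pauli v = case_sum (\<lambda>_. 0) v"

definition pauli_weight :: "'q pauli \<Rightarrow> nat" where
  "pauli_weight p = card {q. p (Inl q) \<noteq> 0 \<or> p (Inr q) \<noteq> 0}"

definition symp :: "'q set \<Rightarrow> 'q pauli \<Rightarrow> 'q pauli \<Rightarrow> bit" where
  "symp Q p p' = (\<Sum>q\<in>Q. p (Inl q) * p' (Inr q) + p (Inr q) * p' (Inl q))"

record ('q, 'c) stabilizer_code =
  phys :: "'q set"
  checks :: "'c set"
  gen :: "'c \<Rightarrow> 'q pauli"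

definition normalizer :: "('q, 'c) stabilizer_code \<Rightarrow> 'q pauli set" where
  "normalizer S = {p \<in> vec_on (phys S <+> phys S). \<forall>c\<in>checks S. symp (phys S) p (gen S c) = 0}"

definition stabilizer :: "('q, 'c) stabilizer_code \<Rightarrow> 'q pauli set" where
  "stabilizer S = {\<Sum>c\<in>C. gen S c | C. C \<subseteq> checks S}"

text \<open>The distance is \<open>\<infinity>\<close> if the code has no nontrivial logical operator.\<close>

definition distance :: "('q, 'c) stabilizer_code \<Rightarrow> enat" where
  "distance S = (INF p \<in> normalizer S - stabilizer S. enat (pauli_weight p))"

definition degree_of_code :: "('q, 'c) stabilizer_code \<Rightarrow> nat" where
  "degree_of_code S = Max ({0}
     \<union> (\<lambda>c. pauli_weight (gen S c)) ` checks S
     \<union> (\<lambda>q. card {c \<in> checks S. gen S c (Inl q) \<noteq> 0}) ` phys S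
     \<union> (\<lambda>q. card {c \<in> checks S. gen S c (Inr q) \<noteq> 0}) ` phys S)"

record ('q, 'x, 'z) css_code =
  qubits :: "'q set"
  xchecks :: "'x set"
  zchecks :: "'z set"
  HX :: "'x \<Rightarrow> 'q \<Rightarrow> bit"
  HZ :: "'z \<Rightarrow> 'q \<Rightarrow> bit"

definition css_stabilizer_code :: "('q, 'x, 'z) css_code \<Rightarrow> ('q, 'x + 'z) stabilizer_code" where
  "css_stabilizer_code Q =
     \<lparr>phys = qubits Q, checks = xchecks Q <+> zchecks Q,
      gen = case_sum (\<lambda>a. x_pauli (HX Q a)) (\<lambda>b. z_pauli (HZ Q b))\<rparr>"

definition z_logical_basis :: "('q, 'x, 'z) css_code \<Rightarrow> ('q \<Rightarrow> bit) set \<Rightarrow> bool" where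
  "z_logical_basis Q B \<longleftrightarrow>
     basis_modulo (ker_on (qubits Q) (HX Q)) (im_on (zchecks Q) (transp (HZ Q))) B"

definition x_logical_basis :: "('q, 'x, 'z) css_code \<Rightarrow> ('q \<Rightarrow> bit) set \<Rightarrow> bool" where
  "x_logical_basis Q B \<longleftrightarrow>
     basis_modulo (ker_on (qubits Q) (HZ Q)) (im_on (xchecks Q) (transp (HX Q))) B"

section \<open>Lifted-product codes\<close>

text \<open>Elements of \<open>R = F\<^sub>2[x]/(x\<^sup>l + 1)\<close> are represented by polynomials.  Matrices over \<open>R\<close> carry the
  reduced representatives; products are formed in \<open>F\<^sub>2[x]\<close> and are reduced when they are
  binarized.\<close>

definition xl1 :: "nat \<Rightarrow> bit poly" where
  "xl1 l = monom 1 l + 1"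

definition R_mat :: "nat \<Rightarrow> nat \<Rightarrow> nat \<Rightarrow> (nat \<Rightarrow> nat \<Rightarrow> bit poly) set" where
  "R_mat l m n = {M \<in> mat_on {..<m} {..<n}. \<forall>i<m. \<forall>j<n. degree (M i j) < l}"

text \<open>In \<open>R\<close> the inverse of \<open>x\<close> is \<open>x\<close> to the power \<open>l - 1\<close>.\<close>

definition R_conj :: "nat \<Rightarrow> bit poly \<Rightarrow> bit poly" where
  "R_conj l f = pcompose f (monom 1 (l - 1)) mod xl1 l"

definition R_star :: "nat \<Rightarrow> ('r \<Rightarrow> 'c \<Rightarrow> bit poly) \<Rightarrow> 'c \<Rightarrow> 'r \<Rightarrow> bit poly" where
  "R_star l M = (\<lambda>i j. R_conj l (M j i))"

definition id_mat :: "nat \<Rightarrow> nat \<Rightarrow> nat \<Rightarrow> bit poly" where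
  "id_mat n = (\<lambda>i j. if i = j \<and> i < n then 1 else 0)"

definition kron ::
  "('r \<Rightarrow> 'c \<Rightarrow> bit poly) \<Rightarrow> ('s \<Rightarrow> 'd \<Rightarrow> bit poly) \<Rightarrow> 'r \<times> 's \<Rightarrow> 'c \<times> 'd \<Rightarrow> bit poly" where
  "kron M N = (\<lambda>(i, j) (i', j'). M i i' * N j j')"

definition append_blocks :: "('r \<Rightarrow> 'c \<Rightarrow> 'k) \<Rightarrow> ('r \<Rightarrow> 'd \<Rightarrow> 'k) \<Rightarrow> 'r \<Rightarrow> 'c + 'd \<Rightarrow> 'k" where
  "append_blocks M N = (\<lambda>i. case_sum (M i) (N i))"

text \<open>Entrywise, the matrix of multiplication in \<open>R\<close> with respect to the basis of powers
  of \<open>x\<close> with exponents below \<open>l\<close>.\<close>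

definition bin_mat :: "nat \<Rightarrow> ('r \<Rightarrow> 'c \<Rightarrow> bit poly) \<Rightarrow> 'r \<times> nat \<Rightarrow> 'c \<times> nat \<Rightarrow> bit" where
  "bin_mat l M = (\<lambda>(i, a) (j, b).
     if a < l \<and> b < l then coeff ((M i j * monom 1 b) mod xl1 l) a else 0)"

definition bin_vec :: "nat \<Rightarrow> ('c \<Rightarrow> bit poly) \<Rightarrow> 'c \<times> nat \<Rightarrow> bit" where
  "bin_vec l w = (\<lambda>(j, b). if b < l then coeff (w j mod xl1 l) b else 0)"

text \<open>A qubit is \<open>(Inl (a, b), c)\<close> in the left or \<open>(Inr (a, b), c)\<close> in the right block, where
  \<open>c\<close> is the exponent of the coefficient.\<close>

type_synonym lp_qubit = "((nat \<times> nat) + (nat \<times> nat)) \<times> nat"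
type_synonym lp_check = "(nat \<times> nat) \<times> nat"

definition LP :: "nat \<Rightarrow> nat \<Rightarrow> nat \<Rightarrow> (nat \<Rightarrow> nat \<Rightarrow> bit poly) \<Rightarrow>
    (lp_qubit, lp_check, lp_check) css_code" where
  "LP l m n A =
     \<lparr>qubits = (({..<n} \<times> {..<n}) <+> ({..<m} \<times> {..<m})) \<times> {..<l},
      xchecks = ({..<m} \<times> {..<n}) \<times> {..<l},
      zchecks = ({..<n} \<times> {..<m}) \<times> {..<l},
      HX = bin_mat l (append_blocks (kron A (id_mat n)) (kron (id_mat m) (R_star l A))),
      HZ = bin_mat l (append_blocks (kron (id_mat n) A) (kron (R_star l A) (id_mat m)))\<rparr>"

text \<open>The \<open>i\<close>-th row of \<open>(I, G)\<close>, with \<open>I\<close> of size \<open>n - m\<close> and \<open>G\<close> of shape \<open>(n - m) \<times> m\<close>.\<close>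

definition u_row :: "nat \<Rightarrow> nat \<Rightarrow> (nat \<Rightarrow> nat \<Rightarrow> bit poly) \<Rightarrow> nat \<Rightarrow> nat \<Rightarrow> bit poly" where
  "u_row m n G i a = (if a < n - m then (if a = i then 1 else 0)
                      else if a < n then G i (a - (n - m)) else 0)"

definition unit_row :: "nat \<Rightarrow> nat \<Rightarrow> bit poly" where
  "unit_row j b = (if b = j then 1 else 0)"

definition left_block_tensor ::
  "nat \<Rightarrow> nat \<Rightarrow> (nat \<Rightarrow> bit poly) \<Rightarrow> (nat \<Rightarrow> bit poly) \<Rightarrow> lp_qubit \<Rightarrow> bit" where
  "left_block_tensor l k v w =
     bin_vec l (case_sum (\<lambda>(a, b). monom 1 k * (v a * w b)) (\<lambda>_. 0))"

definition supp_Zbar ::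
  "nat \<Rightarrow> nat \<Rightarrow> nat \<Rightarrow> (nat \<Rightarrow> nat \<Rightarrow> bit poly) \<Rightarrow> nat \<Rightarrow> nat \<Rightarrow> nat \<Rightarrow> lp_qubit \<Rightarrow> bit" where
  "supp_Zbar l m n G i j k = left_block_tensor l k (u_row m n G i) (unit_row j)"

definition supp_Xbar ::
  "nat \<Rightarrow> nat \<Rightarrow> nat \<Rightarrow> (nat \<Rightarrow> nat \<Rightarrow> bit poly) \<Rightarrow> nat \<Rightarrow> nat \<Rightarrow> nat \<Rightarrow> lp_qubit \<Rightarrow> bit" where
  "supp_Xbar l m n G i j k = left_block_tensor l k (unit_row i) (u_row m n G j)"

definition canonical_LP ::
  "nat \<Rightarrow> nat \<Rightarrow> nat \<Rightarrow> (nat \<Rightarrow> nat \<Rightarrow> bit poly) \<Rightarrow> (nat \<Rightarrow> nat \<Rightarrow> bit poly) \<Rightarrow> bool" where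
  "canonical_LP l m n A G \<longleftrightarrow>
     G \<in> R_mat l (n - m) m \<and>
     (\<exists>B. z_logical_basis (LP l m n A) B \<and>
          (\<forall>i<n - m. \<forall>j<n - m. \<forall>k<l. supp_Zbar l m n G i j k \<in> B)) \<and>
     (\<exists>B. x_logical_basis (LP l m n A) B \<and>
          (\<forall>i<n - m. \<forall>j<n - m. \<forall>k<l. supp_Xbar l m n G i j k \<in> B))"

definition Zbar ::
  "nat \<Rightarrow> nat \<Rightarrow> nat \<Rightarrow> (nat \<Rightarrow> nat \<Rightarrow> bit poly) \<Rightarrow> nat \<Rightarrow> nat \<Rightarrow> nat \<Rightarrow> lp_qubit pauli" where
  "Zbar l m n G i j k = z_pauli (supp_Zbar l m n G i j k)"

definition Xbar ::
  "nat \<Rightarrow> nat \<Rightarrow> nat \<Rightarrow> (nat \<Rightarrow> nat \<Rightarrow> bit poly) \<Rightarrow> nat \<Rightarrow> nat \<Rightarrow> nat \<Rightarrow> lp_qubit pauli" where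
  "Xbar l m n G i j k = x_pauli (supp_Xbar l m n G i j k)"

definition canonical_basis ::
  "nat \<Rightarrow> nat \<Rightarrow> nat \<Rightarrow> (nat \<Rightarrow> nat \<Rightarrow> bit poly) \<Rightarrow> lp_qubit pauli set" where
  "canonical_basis l m n G =
     {Zbar l m n G i j k | i j k. i < n - m \<and> j < n - m \<and> k < l} \<union>
     {Xbar l m n G i j k | i j k. i < n - m \<and> j < n - m \<and> k < l}"

definition seed_operators ::
  "nat \<Rightarrow> nat \<Rightarrow> nat \<Rightarrow> (nat \<Rightarrow> nat \<Rightarrow> bit poly) \<Rightarrow> lp_qubit pauli set" where
  "seed_operators l m n G = {Zbar l m n G i 0 0 | i. i < n - m}"

section \<open>Graph-surgery gadgets\<close>

text \<open>Graphs are loopless; parallel edges are allowed.  A cycle is given by its set of edges.\<close>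

record ('v, 'e) surgery_graph =
  verts :: "'v set"
  edges :: "'e set"
  ends :: "'e \<Rightarrow> 'v set"
  cycles :: "'e set set"

definition bd1 :: "('v, 'e) surgery_graph \<Rightarrow> 'e \<Rightarrow> 'v \<Rightarrow> bit" where
  "bd1 \<G> = (\<lambda>e v. if e \<in> edges \<G> \<and> v \<in> ends \<G> e then 1 else 0)"

definition bd0 :: "('v, 'e) surgery_graph \<Rightarrow> 'e set \<Rightarrow> 'e \<Rightarrow> bit" where
  "bd0 \<G> = (\<lambda>C e. if C \<in> cycles \<G> \<and> e \<in> C then 1 else 0)"

text \<open>Exactness says that the members of \<open>cycles \<G>\<close> have even degree at every vertex, i.e. lie in
  the cycle space, and that they generate it.\<close>

definition valid_graph :: "('v, 'e) surgery_graph \<Rightarrow> bool" where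
  "valid_graph \<G> \<longleftrightarrow>
     finite (verts \<G>) \<and> verts \<G> \<noteq> {} \<and> finite (edges \<G>) \<and>
     (\<forall>e\<in>edges \<G>. ends \<G> e \<subseteq> verts \<G> \<and> card (ends \<G> e) = 2) \<and>
     (\<forall>u\<in>verts \<G>. \<forall>v\<in>verts \<G>. (u, v) \<in> {(a, b). \<exists>e\<in>edges \<G>. ends \<G> e = {a, b}}\<^sup>*) \<and>
     cycles \<G> \<subseteq> Pow (edges \<G>) \<and>
     ker_on (edges \<G>) (bd0 \<G>) = im_on (verts \<G>) (bd1 \<G>)"

definition sound :: "('v, 'e) surgery_graph \<Rightarrow> nat \<Rightarrow> real \<Rightarrow> bool" where
  "sound \<G> t \<rho> \<longleftrightarrow>
     (\<forall>u\<in>vec_on (verts \<G>). hamming (mat_vec (verts \<G>) (bd1 \<G>) u) < t \<longrightarrow>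
        real (hamming (mat_vec (verts \<G>) (bd1 \<G>) u)) \<ge>
          \<rho> * real (Min {hamming (u + v) | v. v \<in> ker_on (verts \<G>) (bd1 \<G>)}))"

text \<open>Rows \<open>Inl q\<close> and \<open>Inr q\<close> of \<open>Phi1\<close> are the X-part and the Z-part of the map \<open>\<Phi>\<^sub>1\<close>.  Rows
  \<open>Inl a\<close> of \<open>Phi0\<close> (X-checks) are the map \<open>\<Phi>\<^sub>0\<close> with superscript Z, rows \<open>Inr b\<close> (Z-checks) the
  one with superscript X.\<close>

record ('q, 'x, 'z, 'v, 'e) gadget =
  graph :: "('v, 'e) surgery_graph"
  Phi1 :: "'q + 'q \<Rightarrow> 'v \<Rightarrow> bit"
  Phi0 :: "'x + 'z \<Rightarrow> 'e \<Rightarrow> bit"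

definition Phi1X :: "('q, 'x, 'z, 'v, 'e) gadget \<Rightarrow> 'q \<Rightarrow> 'v \<Rightarrow> bit" where
  "Phi1X g = (\<lambda>q. Phi1 g (Inl q))"

definition Phi1Z :: "('q, 'x, 'z, 'v, 'e) gadget \<Rightarrow> 'q \<Rightarrow> 'v \<Rightarrow> bit" where
  "Phi1Z g = (\<lambda>q. Phi1 g (Inr q))"

definition Phi0Z :: "('q, 'x, 'z, 'v, 'e) gadget \<Rightarrow> 'x \<Rightarrow> 'e \<Rightarrow> bit" where
  "Phi0Z g = (\<lambda>a. Phi0 g (Inl a))"

definition Phi0X :: "('q, 'x, 'z, 'v, 'e) gadget \<Rightarrow> 'z \<Rightarrow> 'e \<Rightarrow> bit" where
  "Phi0X g = (\<lambda>b. Phi0 g (Inr b))"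

definition gadget_on ::
  "('q, 'x, 'z) css_code \<Rightarrow> ('q, 'x, 'z, 'v, 'e) gadget \<Rightarrow> bool" where
  "gadget_on Q g \<longleftrightarrow>
     valid_graph (graph g) \<and>
     Phi1 g \<in> mat_on (qubits Q <+> qubits Q) (verts (graph g)) \<and>
     Phi0 g \<in> mat_on (xchecks Q <+> zchecks Q) (edges (graph g))"

definition commutation_conditions ::
  "('q, 'x, 'z) css_code \<Rightarrow> ('q, 'x, 'z, 'v, 'e) gadget \<Rightarrow> bool" where
  "commutation_conditions Q g \<longleftrightarrow>
     mat_mul (qubits Q) (transp (Phi1X g)) (Phi1Z g) =
       mat_mul (qubits Q) (transp (Phi1Z g)) (Phi1X g) \<and>
     mat_mul (qubits Q) (HZ Q) (Phi1X g) = mat_mul (edges (graph g)) (Phi0X g) (bd1 (graph g)) \<and>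
     mat_mul (qubits Q) (HX Q) (Phi1Z g) = mat_mul (edges (graph g)) (Phi0Z g) (bd1 (graph g))"

definition measured_operators :: "('q, 'x, 'z, 'v, 'e) gadget \<Rightarrow> 'q pauli set" where
  "measured_operators g =
     mat_vec (verts (graph g)) (Phi1 g) ` ker_on (verts (graph g)) (bd1 (graph g))"

datatype ('x, 'z, 'v, 'e) merged_check =
  X_Check 'x | Z_Check 'z | Vertex_Check 'v | Cycle_Check "'e set"

fun merged_gen :: "('q, 'x, 'z) css_code \<Rightarrow> ('q, 'x, 'z, 'v, 'e) gadget \<Rightarrow>
    ('x, 'z, 'v, 'e) merged_check \<Rightarrow> ('q + 'e) pauli" where
  "merged_gen Q g (X_Check a) = x_pauli (case_sum (HX Q a) (Phi0Z g a))"
| "merged_gen Q g (Z_Check b) = z_pauli (case_sum (HZ Q b) (\<lambda>_. 0))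
                                + x_pauli (case_sum (\<lambda>_. 0) (Phi0X g b))"
| "merged_gen Q g (Vertex_Check v) = x_pauli (case_sum (\<lambda>q. Phi1X g q v) (\<lambda>_. 0))
                                + z_pauli (case_sum (\<lambda>q. Phi1Z g q v) (\<lambda>e. bd1 (graph g) e v))"
| "merged_gen Q g (Cycle_Check C) = x_pauli (case_sum (\<lambda>_. 0) (bd0 (graph g) C))"

definition merged_code :: "('q, 'x, 'z) css_code \<Rightarrow> ('q, 'x, 'z, 'v, 'e) gadget \<Rightarrow>
    ('q + 'e, ('x, 'z, 'v, 'e) merged_check) stabilizer_code" where
  "merged_code Q g =
     \<lparr>phys = qubits Q <+> edges (graph g),
      checks = X_Check ` xchecks Q \<union> Z_Check ` zchecks Q \<union>
               Vertex_Check ` verts (graph g) \<union> Cycle_Check ` cycles (graph g),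
      gen = merged_gen Q g\<rparr>"

text \<open>A row of \<open>Phi1\<close> is nonzero exactly if it belongs to the support of the operator \<open>L\<close>.\<close>

definition elementary :: "('q, 'x, 'z, 'v, 'e) gadget \<Rightarrow> 'q pauli \<Rightarrow> bool" where
  "elementary g L \<longleftrightarrow>
     (\<forall>k. hamming (Phi1 g k) \<le> 1) \<and> (\<forall>k. Phi1 g k \<noteq> 0 \<longleftrightarrow> L k \<noteq> 0)"

definition desiderata ::
  "('q, 'x, 'z) css_code \<Rightarrow> nat \<Rightarrow> nat \<Rightarrow> 'q pauli \<Rightarrow> ('q, 'x, 'z, 'v, 'e) gadget \<Rightarrow> bool" where
  "desiderata Q d \<delta> L g \<longleftrightarrow>
     commutation_conditions Q g \<and> measured_operators g = {0, L} \<and> elementary g L \<and>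
     (\<exists>\<rho>. sound (graph g) d \<rho> \<and>
        \<rho> \<ge> real (max (max_col_weight (verts (graph g)) (Phi1X g))
                      (max_col_weight (verts (graph g)) (Phi1Z g)))) \<and>
     degree_of_code (merged_code Q g) \<le> degree_of_code (css_stabilizer_code Q) + \<delta>"

definition fault_tolerantly_measures ::
  "('q, 'x, 'z) css_code \<Rightarrow> nat \<Rightarrow> ('q, 'x, 'z, 'v, 'e) gadget \<Rightarrow> 'q pauli \<Rightarrow> bool" where
  "fault_tolerantly_measures Q d g L \<longleftrightarrow>
     commutation_conditions Q g \<and> measured_operators g = {0, L} \<and>
     distance (merged_code Q g) \<ge> enat d"

definition rewire :: "('q, 'x, 'z) css_code \<Rightarrow> ('q + 'q \<Rightarrow> 'q + 'q \<Rightarrow> bit) \<Rightarrow>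
    ('x + 'z \<Rightarrow> 'x + 'z \<Rightarrow> bit) \<Rightarrow> ('q, 'x, 'z, 'v, 'e) gadget \<Rightarrow>
    ('q, 'x, 'z, 'v, 'e) gadget" where
  "rewire Q T1 T0 g =
     \<lparr>graph = graph g,
      Phi1 = mat_mul (qubits Q <+> qubits Q) T1 (Phi1 g),
      Phi0 = mat_mul (xchecks Q <+> zchecks Q) T0 (Phi0 g)\<rparr>"

definition transforming_maps :: "('q, 'x, 'z) css_code \<Rightarrow>
    (('q + 'q \<Rightarrow> 'q + 'q \<Rightarrow> bit) \<times> ('x + 'z \<Rightarrow> 'x + 'z \<Rightarrow> bit)) set" where
  "transforming_maps Q =
     mat_on (qubits Q <+> qubits Q) (qubits Q <+> qubits Q) \<times>
     mat_on (xchecks Q <+> zchecks Q) (xchecks Q <+> zchecks Q)"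

end

theory Submission
  imports Defs
begin

text \<open>
  The distance bound for a merged code uses only the commutation conditions, the soundness of the
  graph and the column weights of \<open>\<Phi>\<^sub>1\<close>.  A relabeling of qubits preserves the last two, even if it
  is no symmetry of the code; it only has to match the checks that act on the measured operator.

  A seed is supported in column \<open>0\<close> of the left block.  The X-checks \<open>(a, 0)\<close> see that column through
  \<open>A\<close>, exactly as the X-checks \<open>(a, j)\<close> see column \<open>j\<close> and the Z-checks \<open>(i, a)\<close> see row \<open>i\<close>, and all
  other checks of the same type vanish there.  Hence the seed gadget can be moved to column \<open>j\<close>,
  where it measures a Z-operator, or with X and Z exchanged to row \<open>i\<close>, where it measures an
  X-operator; a cyclic shift of the coefficients adds the power of \<open>x\<close>.
\<close>

section \<open>Linear algebra over the two-element field\<close>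

text \<open>By default \<open>+\<close> and \<open>*\<close> on bits are rewritten to XOR and AND, out of reach of the ring laws.\<close>

declare add_bit_eq_xor [simp del] mult_bit_eq_and [simp del]

lemma bit_add_self [simp]: "(a :: bit) + a = 0"
  by (cases a) (simp_all add: add_bit_eq_xor)

lemma bit_add_cancel: "a + b + (x + a + b) = (x :: bit)"
  by (cases a; cases b; cases x) simp_all

lemma sum_fun_apply: "(\<Sum>i\<in>I. f i) x = (\<Sum>i\<in>I. f i x)"
  by (induction I rule: infinite_finite_induct) simp_all

lemma vec_on_support: "v \<in> vec_on S \<Longrightarrow> {i. v i \<noteq> 0} \<subseteq> S"
  by (auto simp: vec_on_def simp del: bit_not_zero_iff)

text \<open>Over the two-element field a coefficient vector is its support; this turns
  \<open>bd1\<close> applied to \<open>u\<close> into a sum over a set of vertices.\<close>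

lemma sum_bit_mult_support:
  fixes u f :: "'a \<Rightarrow> bit"
  assumes "finite V" "u \<in> vec_on V"
  shows "(\<Sum>v\<in>V. f v * u v) = (\<Sum>v\<in>{v. u v \<noteq> 0}. f v)"
proof -
  have "(\<Sum>v\<in>V. f v * u v) = (\<Sum>v\<in>{v. u v \<noteq> 0}. f v * u v)"
    using assms by (intro sum.mono_neutral_right) (auto simp: vec_on_def)
  then show ?thesis by simp
qed

text \<open>Double annihilator theorem, by induction on the family. If \<open>y\<close> does not
  vanish on the common annihilator of the smaller family, then \<open>y + r i\<close> vanishes
  there.\<close>

lemma annihilator_in_span:
  fixes r :: "'i \<Rightarrow> 'a \<Rightarrow> bit"
  assumes "finite E" "finite I"
    and "\<And>w. w \<in> vec_on E \<Longrightarrow> (\<And>i. i \<in> I \<Longrightarrow> (\<Sum>e\<in>E. r i e * w e) = 0) \<Longrightarrow> (\<Sum>e\<in>E. y e * w e) = 0"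
  shows "\<exists>D\<subseteq>I. \<forall>e\<in>E. y e = (\<Sum>i\<in>D. r i e)"
  using assms(2,3)
proof (induction I arbitrary: y)
  case empty
  have "y e = 0" if "e \<in> E" for e
  proof -
    \<comment> \<open>With no constraints every unit vector is a test vector and reads off one
      coordinate of \<open>y\<close>.\<close>
    have "(\<Sum>e'\<in>E. y e' * (if e' = e then 1 else 0)) = 0"
      using that by (intro empty) (auto simp: vec_on_def)
    then show ?thesis
      using that assms(1) by (simp add: if_distrib[where f = "times _"] cong: if_cong)
  qed
  then show ?case by auto
next
  case (insert i I)
  show ?case
  proof (cases "\<forall>w\<in>vec_on E. (\<forall>j\<in>I. (\<Sum>e\<in>E. r j e * w e) = 0) \<longrightarrow> (\<Sum>e\<in>E. y e * w e) = 0")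
    case True
    then have "\<exists>D\<subseteq>I. \<forall>e\<in>E. y e = (\<Sum>i\<in>D. r i e)"
      by (intro insert.IH) auto
    then show ?thesis by blast
  next
    case False
    then obtain w0 where w0: "w0 \<in> vec_on E" "\<And>j. j \<in> I \<Longrightarrow> (\<Sum>e\<in>E. r j e * w0 e) = 0"
      and y0: "(\<Sum>e\<in>E. y e * w0 e) = 1"
      by auto
    have r0: "(\<Sum>e\<in>E. r i e * w0 e) = 1"
    proof (rule ccontr)
      assume "(\<Sum>e\<in>E. r i e * w0 e) \<noteq> 1"
      then have "(\<Sum>e\<in>E. y e * w0 e) = 0"
        using w0 by (intro insert.prems) auto
      then show False using y0 by simp
    qed
    have "\<exists>D\<subseteq>I. \<forall>e\<in>E. (y + r i) e = (\<Sum>i\<in>D. r i e)"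
    proof (rule insert.IH)
      fix w assume w: "w \<in> vec_on E" "\<And>j. j \<in> I \<Longrightarrow> (\<Sum>e\<in>E. r j e * w e) = 0"
      define c where "c = (\<Sum>e\<in>E. r i e * w e)"
      \<comment> \<open>Since \<open>r i\<close> pairs to 1 with \<open>w0\<close>, adding
        \<open>c\<close> times \<open>w0\<close> makes \<open>w\<close> orthogonal to
        \<open>r i\<close> and keeps it orthogonal to the rows in \<open>I\<close>.\<close>
      define w' where "w' = (\<lambda>e. w e + c * w0 e)"
      have lin: "(\<Sum>e\<in>E. f e * w' e) = (\<Sum>e\<in>E. f e * w e) + c * (\<Sum>e\<in>E. f e * w0 e)" for f
        by (simp add: w'_def algebra_simps sum.distrib sum_distrib_left)
      have "(\<Sum>e\<in>E. y e * w' e) = 0"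
      proof (rule insert.prems)
        show "w' \<in> vec_on E" using w(1) w0(1) by (simp add: w'_def vec_on_def)
        show "(\<Sum>e\<in>E. r j e * w' e) = 0" if "j \<in> insert i I" for j
          using that w(2) w0(2) r0 by (auto simp: lin c_def[symmetric])
      qed
      then have "(\<Sum>e\<in>E. y e * w e) + c = 0"
        using y0 by (simp add: lin)
      then show "(\<Sum>e\<in>E. (y + r i) e * w e) = 0"
        by (simp add: c_def algebra_simps sum.distrib)
    qed
    then obtain D where D: "D \<subseteq> I" "\<And>e. e \<in> E \<Longrightarrow> y e + r i e = (\<Sum>i\<in>D. r i e)"
      by auto
    have "i \<notin> D" "finite D"
      using D(1) insert.hyps by (auto intro: finite_subset)
    then have "y e = (\<Sum>j\<in>insert i D. r j e)" if "e \<in> E" for e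
      using D(2)[OF that, symmetric] by (simp add: ac_simps flip: add.assoc)
    then show ?thesis using D(1) by (intro exI[of _ "insert i D"]) auto
  qed
qed

lemma mat_vec_mat_mul: "mat_vec V (mat_mul J M N) u = mat_vec J M (mat_vec V N u)"
  by (rule ext) (simp add: mat_vec_def mat_mul_def sum_distrib_left sum_distrib_right mult.assoc
      sum.swap[of _ J V])

section \<open>Distance of merged codes\<close>

lemma symp_add_left: "symp Q (p + p') r = symp Q p r + symp Q p' r"
  by (simp add: symp_def algebra_simps sum.distrib)

lemma symp_sum_left: "symp Q (\<Sum>i\<in>I. f i) r = (\<Sum>i\<in>I. symp Q (f i) r)"
proof -
  have "symp Q 0 r = 0" by (simp add: symp_def)
  then show ?thesis
    by (induction I rule: infinite_finite_induct) (simp_all add: symp_add_left)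
qed

lemma symp_Plus:
  assumes "finite A" "finite B"
  shows "symp (A <+> B) p r =
    (\<Sum>q\<in>A. p (Inl (Inl q)) * r (Inr (Inl q)) + p (Inr (Inl q)) * r (Inl (Inl q))) +
    (\<Sum>e\<in>B. p (Inl (Inr e)) * r (Inr (Inr e)) + p (Inr (Inr e)) * r (Inl (Inr e)))"
  using assms by (simp add: symp_def sum.Plus)

text \<open>Exactness dualized: what is orthogonal to the image of \<open>bd1\<close> annihilates
  the kernel of \<open>bd0\<close>, hence lies in the row space of \<open>bd0\<close>. In operator
  terms, X on edges that commutes with all vertex checks is a product of cycle checks.\<close>

lemma bd0_annihilator_in_cycle_span:
  assumes "valid_graph \<G>"
    and y: "\<And>v. v \<in> verts \<G> \<Longrightarrow> (\<Sum>e\<in>edges \<G>. y e * bd1 \<G> e v) = 0"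
  shows "\<exists>D\<subseteq>cycles \<G>. \<forall>e\<in>edges \<G>. y e = (\<Sum>C\<in>D. bd0 \<G> C e)"
proof (rule annihilator_in_span)
  have fin: "finite (edges \<G>)" and "cycles \<G> \<subseteq> Pow (edges \<G>)"
    and ex: "ker_on (edges \<G>) (bd0 \<G>) = im_on (verts \<G>) (bd1 \<G>)"
    using assms(1) by (simp_all add: valid_graph_def)
  then show "finite (edges \<G>)" "finite (cycles \<G>)"
    by (auto intro: finite_subset)
  fix w assume w: "w \<in> vec_on (edges \<G>)"
    "\<And>C. C \<in> cycles \<G> \<Longrightarrow> (\<Sum>e\<in>edges \<G>. bd0 \<G> C e * w e) = 0"
  have "mat_vec (edges \<G>) (bd0 \<G>) w C = 0" for C
    using w(2)[of C] by (cases "C \<in> cycles \<G>") (simp_all add: mat_vec_def bd0_def)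
  then have "w \<in> ker_on (edges \<G>) (bd0 \<G>)"
    using w(1) by (simp add: ker_on_def fun_eq_iff)
  then obtain u where "w = mat_vec (verts \<G>) (bd1 \<G>) u"
    unfolding ex im_on_def by blast
  then have "(\<Sum>e\<in>edges \<G>. y e * w e) =
      (\<Sum>v\<in>verts \<G>. (\<Sum>e\<in>edges \<G>. y e * bd1 \<G> e v) * u v)"
    by (simp add: mat_vec_def sum_distrib_left sum_distrib_right mult.assoc
        sum.swap[of _ "edges \<G>"])
  then show "(\<Sum>e\<in>edges \<G>. y e * w e) = 0"
    using y by simp
qed

text \<open>Soundness bounds the smallest weight in a coset of the kernel. The weights are bounded
  by the number of vertices, so the minimum is attained and the preimage can be moved to a
  minimizer.\<close>

lemma sound_obtain_small_preimage:
  assumes "valid_graph \<G>" "sound \<G> t \<rho>" "w \<in> im_on (verts \<G>) (bd1 \<G>)" "hamming w < t"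
  obtains u where "u \<in> vec_on (verts \<G>)" "w = mat_vec (verts \<G>) (bd1 \<G>) u"
    "\<rho> * real (hamming u) \<le> real (hamming w)"
proof -
  let ?V = "verts \<G>"
  let ?K = "ker_on ?V (bd1 \<G>)"
  obtain u where u: "u \<in> vec_on ?V" "w = mat_vec ?V (bd1 \<G>) u"
    using assms(3) by (auto simp: im_on_def)
  let ?H = "{hamming (u + v) | v. v \<in> ?K}"
  have "finite ?V" using assms(1) by (simp add: valid_graph_def)
  have "h \<le> card ?V" if "h \<in> ?H" for h
  proof -
    from that obtain v where v: "v \<in> vec_on ?V" "h = hamming (u + v)"
      by (auto simp: ker_on_def)
    have "{i. (u + v) i \<noteq> 0} \<subseteq> ?V"
      using u(1) v(1) by (intro vec_on_support) (simp add: vec_on_def)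
    then show ?thesis
      using v(2) card_mono[OF \<open>finite ?V\<close>] by (simp add: hamming_def)
  qed
  then have "finite ?H" by (meson finite_nat_set_iff_bounded_le)
  moreover have "0 \<in> ?K" by (simp add: ker_on_def vec_on_def mat_vec_def fun_eq_iff)
  then have "?H \<noteq> {}" by blast
  ultimately have "Min ?H \<in> ?H" by (rule Min_in)
  then obtain v where v: "v \<in> ?K" "Min ?H = hamming (u + v)" by blast
  show thesis
  proof
    show "u + v \<in> vec_on ?V" using u(1) v(1) by (simp add: ker_on_def vec_on_def)
    have "mat_vec ?V (bd1 \<G>) (u + v) = mat_vec ?V (bd1 \<G>) u + mat_vec ?V (bd1 \<G>) v"
      by (rule ext) (simp add: mat_vec_def algebra_simps sum.distrib)
    then show "w = mat_vec ?V (bd1 \<G>) (u + v)"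
      using u(2) v(1) by (simp add: ker_on_def)
    show "\<rho> * real (hamming (u + v)) \<le> real (hamming w)"
      using assms(2,4) u unfolding sound_def v(2)[symmetric] by blast
  qed
qed

lemma stabilizer_if_light:
  assumes "distance S \<ge> enat d" "p \<in> normalizer S" "pauli_weight p < d"
  shows "p \<in> stabilizer S"
proof (rule ccontr)
  assume "p \<notin> stabilizer S"
  then have "distance S \<le> enat (pauli_weight p)"
    unfolding distance_def using assms(2) by (intro INF_lower) simp
  then show False using assms(1,3) by (metis enat_ord_simps(1) leD order.trans)
qed

text \<open>A light operator of the merged code is cleaned in three steps: vertex checks, chosen by
  soundness, remove its Z-part on the edges without spoiling the weight bound on the data; what is
  left on the data is a light logical operator of the original code, hence a product of checks;
  the remaining X-part on the edges is a product of cycle checks.\<close>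

lemma distance_merged_code_ge:
  assumes fin: "finite (qubits Q)" and finc: "finite (xchecks Q)" "finite (zchecks Q)"
    and g: "gadget_on Q g" and cc: "commutation_conditions Q g"
    and snd: "sound (graph g) d \<rho>"
    and col: "\<And>v. v \<in> verts (graph g) \<Longrightarrow> real (pauli_weight (\<lambda>k. Phi1 g k v)) \<le> \<rho>"
    and dist: "distance (css_stabilizer_code Q) \<ge> enat d"
  shows "distance (merged_code Q g) \<ge> enat d"
proof -
  let ?V = "verts (graph g)" and ?E = "edges (graph g)" and ?bd1 = "bd1 (graph g)"
  let ?N = "qubits Q"
  let ?M = "merged_code Q g"
  let ?gen = "merged_gen Q g"
  have vg: "valid_graph (graph g)"
    and P1: "\<And>k v. k \<notin> ?N <+> ?N \<Longrightarrow> Phi1 g k v = 0"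
    and P0: "\<And>c e. e \<notin> ?E \<Longrightarrow> Phi0 g c e = 0"
    using g by (auto simp: gadget_on_def mat_on_def)
  have finV: "finite ?V" and finE: "finite ?E" and cyc: "cycles (graph g) \<subseteq> Pow ?E"
    using vg by (simp_all add: valid_graph_def)
  have ex: "ker_on ?E (bd0 (graph g)) = im_on ?V ?bd1"
    using vg by (simp add: valid_graph_def)
  have phys: "phys ?M = ?N <+> ?E" by (simp add: merged_code_def)
  note sP = symp_Plus[OF fin finE]
  have cc1: "(\<Sum>q\<in>?N. Phi1 g (Inl q) v * Phi1 g (Inr q) v') =
      (\<Sum>q\<in>?N. Phi1 g (Inr q) v * Phi1 g (Inl q) v')" for v v'
    using cc by (auto simp: commutation_conditions_def mat_mul_def transp_def Phi1X_def Phi1Z_def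
        fun_eq_iff)
  have cc2: "(\<Sum>q\<in>?N. HZ Q b q * Phi1 g (Inl q) v) = (\<Sum>e\<in>?E. Phi0 g (Inr b) e * ?bd1 e v)" for b v
    using cc by (auto simp: commutation_conditions_def mat_mul_def Phi1X_def Phi0X_def fun_eq_iff)
  have cc3: "(\<Sum>q\<in>?N. HX Q a q * Phi1 g (Inr q) v) = (\<Sum>e\<in>?E. Phi0 g (Inl a) e * ?bd1 e v)" for a v
    using cc by (auto simp: commutation_conditions_def mat_mul_def Phi1Z_def Phi0Z_def fun_eq_iff)
  \<comment> \<open>On the edges vertex checks are pure Z, so only their data parts could
    anticommute.\<close>
  have VV: "symp (?N <+> ?E) (?gen (Vertex_Check v)) (?gen (Vertex_Check v')) = 0" for v v'
    by (simp add: sP x_pauli_def z_pauli_def Phi1X_def Phi1Z_def sum.distrib cc1[of v v'])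
  \<comment> \<open>By the commutation condition data and edges contribute the same bit, and the two
    cancel.\<close>
  have VX: "symp (?N <+> ?E) (?gen (Vertex_Check v)) (?gen (X_Check a)) = 0"
    "symp (?N <+> ?E) (?gen (X_Check a)) (?gen (Vertex_Check v)) = 0" for v a
    using cc3[of a v]
    by (simp_all add: sP x_pauli_def z_pauli_def Phi1X_def Phi1Z_def Phi0Z_def mult.commute)
  have VZ: "symp (?N <+> ?E) (?gen (Vertex_Check v)) (?gen (Z_Check b)) = 0"
    "symp (?N <+> ?E) (?gen (Z_Check b)) (?gen (Vertex_Check v)) = 0" for v b
    using cc2[of b v]
    by (simp_all add: sP x_pauli_def z_pauli_def Phi1X_def Phi1Z_def Phi0X_def mult.commute)
  have "p \<in> stabilizer ?M" if p: "p \<in> normalizer ?M" and wt: "pauli_weight p < d" for p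
  proof -
    have pM: "symp (?N <+> ?E) p (?gen c) = 0" if "c \<in> checks ?M" for c
      using p that by (simp add: normalizer_def merged_code_def)
    have pout: "p k = 0" if "k \<notin> (?N <+> ?E) <+> (?N <+> ?E)" for k
      using p that by (simp add: normalizer_def merged_code_def vec_on_def)
    let ?dat = "{q. p (Inl (Inl q)) \<noteq> 0 \<or> p (Inr (Inl q)) \<noteq> 0}"
    define w where "w = (\<lambda>e. p (Inr (Inr e)))"
    have dat_sub: "?dat \<subseteq> ?N" using pout by fastforce
    have w_on: "w \<in> vec_on ?E" using pout by (auto simp: w_def vec_on_def)
    \<comment> \<open>Data qubits and edges with a Z-part are disjoint pieces of the support; edges
      carrying X alone are left out, hence the inequality.\<close>
    have hw: "card ?dat + hamming w \<le> pauli_weight p"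
    proof -
      have sub: "?dat <+> {e. w e \<noteq> 0} \<subseteq> {q. p (Inl q) \<noteq> 0 \<or> p (Inr q) \<noteq> 0}"
        by (auto simp: w_def)
      have "{q. p (Inl q) \<noteq> 0 \<or> p (Inr q) \<noteq> 0} \<subseteq> ?N <+> ?E"
      proof (rule subsetI, rule ccontr)
        fix x assume "x \<in> {q. p (Inl q) \<noteq> 0 \<or> p (Inr q) \<noteq> 0}" "x \<notin> ?N <+> ?E"
        moreover from this(2) have "p (Inl x) = 0" "p (Inr x) = 0"
          by (auto intro!: pout)
        ultimately show False by simp
      qed
      then have f: "finite {q. p (Inl q) \<noteq> 0 \<or> p (Inr q) \<noteq> 0}"
        using fin finE by (meson finite_Plus finite_subset)
      have "finite ?dat" "finite {e. w e \<noteq> 0}"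
        using finite_subset[OF dat_sub fin] finite_subset[OF vec_on_support[OF w_on] finE] by auto
      then show ?thesis
        using card_mono[OF f sub] by (simp add: card_Plus hamming_def pauli_weight_def)
    qed
    \<comment> \<open>Commuting with the cycle checks puts the Z-part on the edges into the kernel
      of \<open>bd0\<close>, which is the image of \<open>bd1\<close>.\<close>
    have "mat_vec ?E (bd0 (graph g)) w C = 0" for C
    proof (cases "C \<in> cycles (graph g)")
      case True
      then have "symp (?N <+> ?E) p (?gen (Cycle_Check C)) = 0"
        by (intro pM) (simp add: merged_code_def)
      then show ?thesis
        by (simp add: sP x_pauli_def mat_vec_def w_def mult.commute)
    qed (simp add: mat_vec_def bd0_def)
    then have w_im: "w \<in> im_on ?V ?bd1"
      using w_on unfolding ex[symmetric] by (simp add: ker_on_def fun_eq_iff)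
    have "hamming w < d" using hw wt by linarith
    then obtain u where u: "u \<in> vec_on ?V" "w = mat_vec ?V ?bd1 u"
      "\<rho> * real (hamming u) \<le> real (hamming w)"
      by (rule sound_obtain_small_preimage[OF vg snd w_im])
    define U where "U = {v. u v \<noteq> 0}"
    have UV: "U \<subseteq> ?V" using u(1) by (auto simp: U_def vec_on_def)
    then have finU: "finite U" using finV finite_subset by blast
    \<comment> \<open>As \<open>bd1\<close> maps \<open>u\<close> to \<open>w\<close>, these vertex
      checks cancel the Z-part on the edges.\<close>
    define p' where "p' = p + (\<Sum>v\<in>U. ?gen (Vertex_Check v))"
    have p'_edge: "p' (Inr (Inr e)) = 0" for e
    proof -
      have "w e = (\<Sum>v\<in>U. ?bd1 e v)"
        unfolding u(2) U_def mat_vec_def using sum_bit_mult_support[OF finV u(1)] .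
      then show ?thesis
        by (simp add: p'_def sum_fun_apply x_pauli_def z_pauli_def w_def)
    qed
    have p'X: "symp (?N <+> ?E) p' (?gen (X_Check a)) = 0" if "a \<in> xchecks Q" for a
      using pM[of "X_Check a"] that VX
      by (simp add: p'_def symp_add_left symp_sum_left merged_code_def del: merged_gen.simps)
    have p'Z: "symp (?N <+> ?E) p' (?gen (Z_Check b)) = 0" if "b \<in> zchecks Q" for b
      using pM[of "Z_Check b"] that VZ
      by (simp add: p'_def symp_add_left symp_sum_left merged_code_def del: merged_gen.simps)
    have p'V: "symp (?N <+> ?E) p' (?gen (Vertex_Check v)) = 0" if "v \<in> ?V" for v
      using pM[of "Vertex_Check v"] that VV
      by (simp add: p'_def symp_add_left symp_sum_left merged_code_def del: merged_gen.simps)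
    define p0 :: "'a pauli" where
      "p0 = case_sum (\<lambda>q. p' (Inl (Inl q))) (\<lambda>q. p' (Inr (Inl q)))"
    have p0_Inl: "p0 (Inl q) = p (Inl (Inl q)) + (\<Sum>v\<in>U. Phi1 g (Inl q) v)"
      and p0_Inr: "p0 (Inr q) = p (Inr (Inl q)) + (\<Sum>v\<in>U. Phi1 g (Inr q) v)" for q
      by (simp_all add: p0_def p'_def sum_fun_apply x_pauli_def z_pauli_def Phi1X_def Phi1Z_def)
    \<comment> \<open>The merged X- and Z-checks act on the edges by X only, where \<open>p'\<close>
      has no Z-part, so commutation is decided on the data.\<close>
    have "p0 \<in> normalizer (css_stabilizer_code Q)"
    proof -
      have "p0 k = 0" if "k \<notin> ?N <+> ?N" for k
      proof (cases k)
        case (Inl q)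
        with that have "Inl (Inl q) \<notin> (?N <+> ?E) <+> (?N <+> ?E)" by auto
        then show ?thesis using that pout P1 by (simp add: Inl p0_Inl)
      next
        case (Inr q)
        with that have "Inr (Inl q) \<notin> (?N <+> ?E) <+> (?N <+> ?E)" by auto
        then show ?thesis using that pout P1 by (simp add: Inr p0_Inr)
      qed
      moreover have "symp ?N p0 (x_pauli (HX Q a)) = 0" if "a \<in> xchecks Q" for a
        using p'X[OF that] unfolding sP by (simp add: p'_edge x_pauli_def symp_def p0_def)
      moreover have "symp ?N p0 (z_pauli (HZ Q b)) = 0" if "b \<in> zchecks Q" for b
        using p'Z[OF that] unfolding sP by (simp add: p'_edge x_pauli_def z_pauli_def symp_def p0_def)
      ultimately show ?thesis
        by (auto simp: normalizer_def css_stabilizer_code_def vec_on_def)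
    qed
    \<comment> \<open>Each vertex check touches at most \<open>\<rho>\<close> data qubits, so
      cleaning adds at most \<open>\<rho>\<close> times the weight of \<open>u\<close>, which is no
      more than the edge weight removed.\<close>
    moreover have "pauli_weight p0 < d"
    proof -
      let ?c = "\<lambda>v. {q. Phi1 g (Inl q) v \<noteq> 0 \<or> Phi1 g (Inr q) v \<noteq> 0}"
      have cN: "?c v \<subseteq> ?N" for v using P1 by fastforce
      have fc: "finite (?c v)" for v using cN[of v] fin by (rule finite_subset)
      have "{q. p0 (Inl q) \<noteq> 0 \<or> p0 (Inr q) \<noteq> 0} \<subseteq> ?dat \<union> (\<Union>v\<in>U. ?c v)"
      proof (rule subsetI, rule ccontr)
        fix q assume q: "q \<in> {q. p0 (Inl q) \<noteq> 0 \<or> p0 (Inr q) \<noteq> 0}"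
          "q \<notin> ?dat \<union> (\<Union>v\<in>U. ?c v)"
        then have "(\<Sum>v\<in>U. Phi1 g (Inl q) v) = 0" "(\<Sum>v\<in>U. Phi1 g (Inr q) v) = 0"
          by (auto intro!: sum.neutral)
        with q show False by (simp add: p0_Inl p0_Inr)
      qed
      then have "pauli_weight p0 \<le> card (?dat \<union> (\<Union>v\<in>U. ?c v))"
        unfolding pauli_weight_def using fc finU finite_subset[OF dat_sub fin]
        by (intro card_mono) simp_all
      also have "\<dots> \<le> card ?dat + (\<Sum>v\<in>U. card (?c v))"
        by (rule order.trans[OF card_Un_le add_left_mono[OF card_UN_le[OF finU]]])
      finally have "real (pauli_weight p0) \<le> real (card ?dat) + (\<Sum>v\<in>U. real (card (?c v)))"
        by (simp flip: of_nat_sum of_nat_add)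
      also have "(\<Sum>v\<in>U. real (card (?c v))) \<le> (\<Sum>v\<in>U. \<rho>)"
        using col UV unfolding pauli_weight_def by (intro sum_mono) auto
      also have "\<dots> = \<rho> * real (hamming u)" by (simp add: hamming_def U_def)
      also note u(3)
      finally show ?thesis using hw wt by simp
    qed
    ultimately have "p0 \<in> stabilizer (css_stabilizer_code Q)"
      by (rule stabilizer_if_light[OF dist])
    then obtain C where C: "C \<subseteq> xchecks Q <+> zchecks Q"
      "p0 = (\<Sum>c\<in>C. case_sum (\<lambda>a. x_pauli (HX Q a)) (\<lambda>b. z_pauli (HZ Q b)) c)"
      by (auto simp: stabilizer_def css_stabilizer_code_def)
    define emb :: "'b + 'c \<Rightarrow> ('b, 'c, 'd, 'e) merged_check" where
      "emb = case_sum X_Check Z_Check"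
    have emb_inj: "inj emb" by (auto simp: inj_def emb_def split: sum.splits)
    \<comment> \<open>Merged checks restrict on the data to those of \<open>Q\<close>, so the data
      part cancels; at most an X-part on the edges is left.\<close>
    define p'' where "p'' = p' + (\<Sum>c\<in>C. ?gen (emb c))"
    have p''_data: "p'' (Inl (Inl q)) = 0" "p'' (Inr (Inl q)) = 0" for q
    proof -
      have "?gen (emb c) (Inl (Inl q)) =
            case_sum (\<lambda>a. x_pauli (HX Q a)) (\<lambda>b. z_pauli (HZ Q b)) c (Inl q)"
           "?gen (emb c) (Inr (Inl q)) =
            case_sum (\<lambda>a. x_pauli (HX Q a)) (\<lambda>b. z_pauli (HZ Q b)) c (Inr q)" for c
        by (cases c; simp add: emb_def x_pauli_def z_pauli_def)+
      then have "(\<Sum>c\<in>C. ?gen (emb c) (Inl (Inl q))) = p0 (Inl q)"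
           "(\<Sum>c\<in>C. ?gen (emb c) (Inr (Inl q))) = p0 (Inr q)"
        unfolding C(2) by (simp_all add: sum_fun_apply)
      then show "p'' (Inl (Inl q)) = 0" "p'' (Inr (Inl q)) = 0"
        by (simp_all add: p''_def sum_fun_apply p0_def)
    qed
    have emb_edge: "?gen (emb c) (Inr (Inr e)) = 0" for c e
      by (cases c) (simp_all add: emb_def x_pauli_def z_pauli_def)
    then have p''_edge: "p'' (Inr (Inr e)) = 0" for e
      by (simp add: p''_def sum_fun_apply p'_edge)
    define y where "y = (\<lambda>e. p'' (Inl (Inr e)))"
    have y_out: "y e = 0" if "e \<notin> ?E" for e
    proof -
      have "?gen (emb c) (Inl (Inr e)) = 0" for c
        using P0[OF that]
        by (cases c) (simp_all add: emb_def x_pauli_def z_pauli_def Phi0X_def Phi0Z_def)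
      moreover have "p (Inl (Inr e)) = 0" using that by (intro pout) auto
      ultimately show ?thesis
        by (simp add: y_def p''_def p'_def sum_fun_apply x_pauli_def z_pauli_def)
    qed
    \<comment> \<open>Without data part and Z-part, commuting with the vertex checks says that
      \<open>y\<close> is a cycle.\<close>
    have "(\<Sum>e\<in>?E. y e * ?bd1 e v) = 0" if "v \<in> ?V" for v
    proof -
      have "symp (?N <+> ?E) (?gen (emb c)) (?gen (Vertex_Check v)) = 0" for c
        using VX(2) VZ(2) by (cases c) (simp_all add: emb_def del: merged_gen.simps)
      then have "symp (?N <+> ?E) p'' (?gen (Vertex_Check v)) = 0"
        using p'V[OF that]
        by (simp add: p''_def symp_add_left symp_sum_left del: merged_gen.simps)
      then show ?thesis
        by (simp add: sP p''_data p''_edge y_def x_pauli_def z_pauli_def)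
    qed
    from bd0_annihilator_in_cycle_span[OF vg this] obtain D
      where D: "D \<subseteq> cycles (graph g)" "\<forall>e\<in>?E. y e = (\<Sum>C\<in>D. bd0 (graph g) C e)"
      by blast
    have yD: "y e = (\<Sum>C\<in>D. bd0 (graph g) C e)" for e
    proof (cases "e \<in> ?E")
      case False
      then have "bd0 (graph g) C e = 0" if "C \<in> D" for C
        using that D(1) cyc by (auto simp: bd0_def)
      then show ?thesis using y_out[OF False] by simp
    qed (use D(2) in blast)
    have p'': "p'' = (\<Sum>C\<in>D. ?gen (Cycle_Check C))"
    proof
      fix k
      show "p'' k = (\<Sum>C\<in>D. ?gen (Cycle_Check C)) k"
      proof (cases k)
        case (Inl q)
        then show ?thesis
          using p''_data yD by (cases q) (simp_all add: sum_fun_apply x_pauli_def y_def)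
      next
        case (Inr q)
        then show ?thesis
          using p''_data p''_edge by (cases q) (simp_all add: sum_fun_apply x_pauli_def)
      qed
    qed
    let ?S = "Vertex_Check ` U \<union> emb ` C \<union> Cycle_Check ` D"
    have finD: "finite D"
      using D(1) cyc finE by (meson finite_Pow_iff finite_subset)
    have "emb c \<in> X_Check ` xchecks Q \<union> Z_Check ` zchecks Q" if "c \<in> C" for c
      using subsetD[OF C(1) that] by (cases c) (auto simp: emb_def)
    then have sub: "?S \<subseteq> checks ?M"
      using UV D(1) by (auto simp: merged_code_def)
    have "(\<Sum>v\<in>Vertex_Check ` U. ?gen v) = (\<Sum>v\<in>U. ?gen (Vertex_Check v))"
      "(\<Sum>c\<in>emb ` C. ?gen c) = (\<Sum>c\<in>C. ?gen (emb c))"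
      "(\<Sum>c\<in>Cycle_Check ` D. ?gen c) = (\<Sum>c\<in>D. ?gen (Cycle_Check c))"
      by (subst sum.reindex;
          use inj_on_subset[OF emb_inj subset_UNIV] in
            \<open>simp add: inj_on_def o_def del: merged_gen.simps\<close>)+
    moreover have "p = (\<Sum>v\<in>U. ?gen (Vertex_Check v)) + (\<Sum>c\<in>C. ?gen (emb c)) + p''"
      unfolding p''_def p'_def fun_eq_iff plus_fun_apply bit_add_cancel by simp
    \<comment> \<open>The three families have different constructors, so the sum over their union
      splits.\<close>
    moreover have "(\<Sum>c\<in>?S. ?gen c) = (\<Sum>c\<in>Vertex_Check ` U. ?gen c) + (\<Sum>c\<in>emb ` C. ?gen c) +
        (\<Sum>c\<in>Cycle_Check ` D. ?gen c)"
    proof -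
      have "finite C" using C(1) finc by (meson finite_Plus finite_subset)
      moreover have "Vertex_Check v \<noteq> emb c" "Cycle_Check x \<noteq> emb c" for v c x
        by (cases c; simp add: emb_def)+
      ultimately show ?thesis
        using finU finD by (subst sum.union_disjoint; (subst sum.union_disjoint)?) auto
    qed
    ultimately have "p = (\<Sum>c\<in>?S. ?gen c)"
      unfolding p'' by (simp only:)
    then have "p = (\<Sum>c\<in>?S. gen ?M c)"
      by (simp add: merged_code_def)
    with sub show ?thesis
      unfolding stabilizer_def by blast
  qed
  then show ?thesis
    unfolding distance_def by (intro INF_greatest) (force simp: not_less)
qed

section \<open>Rewiring along a relabeling\<close>

text \<open>Unit vectors outside \<open>D\<close> are sent to zero, so \<open>f\<close> matters on
  \<open>D\<close> only and need not extend to a symmetry of the whole index set.\<close>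

definition relabel :: "'c set \<Rightarrow> ('c \<Rightarrow> 'r) \<Rightarrow> 'r \<Rightarrow> 'c \<Rightarrow> bit" where
  "relabel D f = (\<lambda>k k'. if k' \<in> D \<and> k = f k' then 1 else 0)"

lemma relabel_mat_on: "f ` D \<subseteq> I \<Longrightarrow> D \<subseteq> J \<Longrightarrow> relabel D f \<in> mat_on I J"
  by (auto simp: relabel_def mat_on_def)

lemma mat_vec_relabel_image:
  assumes "finite J" "D \<subseteq> J" "inj_on f D" "k \<in> D"
  shows "mat_vec J (relabel D f) v (f k) = v k"
proof -
  have "mat_vec J (relabel D f) v (f k) = (\<Sum>j\<in>J. if j = k then v j else 0)"
    unfolding mat_vec_def relabel_def using assms(3,4)
    by (intro sum.cong) (auto dest: inj_onD)
  then show ?thesis using assms by auto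
qed

lemma mat_vec_relabel_eq_0: "k \<notin> f ` {j \<in> D. v j \<noteq> 0} \<Longrightarrow> mat_vec J (relabel D f) v k = 0"
  unfolding mat_vec_def relabel_def by (intro sum.neutral) auto

text \<open>The new support lies in the image of the old one under \<open>f\<close>; collisions can
  only lower the weight.\<close>

lemma hamming_mat_vec_relabel_le:
  assumes "finite {k. v k \<noteq> 0}"
  shows "hamming (mat_vec J (relabel D f) v) \<le> hamming v"
proof -
  have "{k. mat_vec J (relabel D f) v k \<noteq> 0} \<subseteq> f ` {k. v k \<noteq> 0}"
    using mat_vec_relabel_eq_0[where f = f and v = v and D = D and J = J] by blast
  then show ?thesis
    unfolding hamming_def using assms by (rule surj_card_le[rotated])
qed

lemma pauli_weight_le_hamming:
  assumes "finite {k. p k \<noteq> 0}"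
  shows "pauli_weight p \<le> hamming p"
proof -
  have "{q. p (Inl q) \<noteq> 0 \<or> p (Inr q) \<noteq> 0} \<subseteq> (\<lambda>k. case k of Inl q \<Rightarrow> q | Inr q \<Rightarrow> q) ` {k. p k \<noteq> 0}"
    by (force simp del: bit_not_zero_iff)
  then show ?thesis
    unfolding hamming_def pauli_weight_def using assms by (rule surj_card_le[rotated])
qed

lemma mat_mul_eq_mat_vec: "mat_mul J M N i k = mat_vec J M (\<lambda>j. N j k) i"
  by (simp add: mat_mul_def mat_vec_def)

lemma gadget_on_rewire:
  assumes "gadget_on Q g" "(T1, T0) \<in> transforming_maps Q"
  shows "gadget_on Q (rewire Q T1 T0 g)"
  using assms
  by (auto simp: gadget_on_def rewire_def transforming_maps_def mat_on_def mat_mul_def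
      intro!: sum.neutral)

text \<open>Relabeling does not increase column weights, so the soundness of the seed graph suffices for
  the rewired gadget as well.\<close>

lemma rewire_relabel_fault_tolerant:
  assumes fin: "finite (qubits Q)" "finite (xchecks Q)" "finite (zchecks Q)"
    and g: "gadget_on Q g" and T: "(relabel D f, T0) \<in> transforming_maps Q"
    and cc: "commutation_conditions Q (rewire Q (relabel D f) T0 g)"
    and L: "measured_operators g = {0, L}"
    and snd: "sound (graph g) d \<rho>"
    and col: "\<And>v. v \<in> verts (graph g) \<Longrightarrow> real (hamming (\<lambda>k. Phi1 g k v)) \<le> \<rho>"
    and dist: "distance (css_stabilizer_code Q) \<ge> enat d"
  shows "fault_tolerantly_measures Q d (rewire Q (relabel D f) T0 g)
    (mat_vec (qubits Q <+> qubits Q) (relabel D f) L)"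
proof -
  let ?J = "qubits Q <+> qubits Q"
  let ?g = "rewire Q (relabel D f) T0 g"
  have "measured_operators ?g = mat_vec ?J (relabel D f) ` measured_operators g"
    by (simp add: measured_operators_def rewire_def mat_vec_mat_mul image_image)
  also have "\<dots> = {0, mat_vec ?J (relabel D f) L}"
    unfolding L by (auto simp: mat_vec_def fun_eq_iff)
  finally have "measured_operators ?g = {0, mat_vec ?J (relabel D f) L}" .
  moreover have "distance (merged_code Q ?g) \<ge> enat d"
  proof (rule distance_merged_code_ge[OF fin gadget_on_rewire[OF g T] cc])
    show "sound (graph ?g) d \<rho>" using snd by (simp add: rewire_def)
    fix v assume "v \<in> verts (graph ?g)"
    then have v: "v \<in> verts (graph g)" by (simp add: rewire_def)
    let ?c = "\<lambda>k. Phi1 g k v" and ?c' = "\<lambda>k. Phi1 ?g k v"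
    have c': "?c' = mat_vec ?J (relabel D f) ?c"
      by (simp add: rewire_def mat_mul_eq_mat_vec)
    have "{k. h k v \<noteq> 0} \<subseteq> ?J" if "h \<in> mat_on ?J V" for h :: "_ \<Rightarrow> _ \<Rightarrow> bit" and V
      using that by (auto simp: mat_on_def simp del: bit_not_zero_iff)
    then have "finite {k. ?c k \<noteq> 0}" "finite {k. ?c' k \<noteq> 0}"
      using g gadget_on_rewire[OF g T] fin(1) unfolding gadget_on_def
      by (meson finite_Plus finite_subset)+
    \<comment> \<open>The Pauli weight is at most the Hamming weight after relabeling, and that is
      at most the one before.\<close>
    then have "pauli_weight ?c' \<le> hamming ?c"
      using pauli_weight_le_hamming[of ?c'] hamming_mat_vec_relabel_le[of ?c ?J D f]
      unfolding c' by linarith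
    then show "real (pauli_weight ?c') \<le> \<rho>" using col[OF v] by linarith
  qed (fact dist)
  ultimately show ?thesis using cc by (simp add: fault_tolerantly_measures_def)
qed

text \<open>Row \<open>h0 a\<close> of the new identity is row \<open>a\<close> of the old one after
  reindexing by \<open>h\<close>; in every other row both sides vanish. The factor \<open>B\<close>
  is the same in both, being the boundary map of an unchanged graph in the applications.\<close>

lemma mat_mul_transport:
  assumes "finite J" "N \<subseteq> J" "inj_on h N" "h ` N \<subseteq> J"
    and eq: "mat_mul J H P = mat_mul E F B"
    and P: "\<And>q v. q \<notin> N \<Longrightarrow> P q v = 0"
    and P': "\<And>q. q \<in> N \<Longrightarrow> P' (h q) = P q" "\<And>q v. q \<notin> h ` N \<Longrightarrow> P' q v = 0"
    and F': "\<And>a. a \<in> M \<Longrightarrow> F' (h0 a) = F a" "\<And>a e. a \<notin> h0 ` M \<Longrightarrow> F' a e = 0"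
    and H': "\<And>a q. a \<in> M \<Longrightarrow> q \<in> N \<Longrightarrow> H' (h0 a) (h q) = H a q"
      "\<And>a q. a \<notin> h0 ` M \<Longrightarrow> q \<in> N \<Longrightarrow> H' a (h q) = 0"
  shows "mat_mul J H' P' = mat_mul E F' B"
proof (intro ext)
  fix a' v
  have "mat_mul J H' P' a' v = (\<Sum>q\<in>h ` N. H' a' q * P' q v)"
    unfolding mat_mul_def using assms(1,4) P'(2) by (intro sum.mono_neutral_right) auto
  also have "\<dots> = (\<Sum>q\<in>N. H' a' (h q) * P q v)"
    using assms(3) P'(1) by (simp add: sum.reindex)
  also have "\<dots> = mat_mul E F' B a' v"
  proof (cases "a' \<in> h0 ` M")
    case True
    then obtain a where a: "a \<in> M" "a' = h0 a" by blast
    have "(\<Sum>q\<in>N. H' a' (h q) * P q v) = (\<Sum>q\<in>N. H a q * P q v)"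
      using a H'(1) by simp
    also have "\<dots> = mat_mul J H P a v"
      unfolding mat_mul_def using assms(1,2) P by (intro sum.mono_neutral_left) auto
    also have "\<dots> = mat_mul E F' B a' v"
      using a F'(1) by (simp add: eq) (simp add: mat_mul_def)
    finally show ?thesis .
  next
    case False
    then show ?thesis using H'(2) F'(2) by (simp add: mat_mul_def)
  qed
  finally show "mat_mul J H' P' a' v = mat_mul E F' B a' v" .
qed

text \<open>Only the rows of \<open>\<Phi>\<^sub>0\<close> at the X-checks in \<open>M\<close> are kept.  For the seeds of a lifted product the
  other rows are cycles, so the commutation conditions do not see them.\<close>

lemma commutation_rewire_Z_to_Z:
  assumes fin: "finite (qubits Q)" "finite (xchecks Q)" "finite (zchecks Q)"
    and cc: "commutation_conditions Q g"
    and X0: "\<And>q v. Phi1 g (Inl q) v = 0" and N0: "\<And>q v. q \<notin> N \<Longrightarrow> Phi1 g (Inr q) v = 0"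
    and N: "N \<subseteq> qubits Q" "inj_on h N" "h ` N \<subseteq> qubits Q"
    and M: "M \<subseteq> xchecks Q" "inj_on h0 M"
    and H: "\<And>a q. a \<in> M \<Longrightarrow> q \<in> N \<Longrightarrow> HX Q (h0 a) (h q) = HX Q a q"
      "\<And>a q. a \<notin> h0 ` M \<Longrightarrow> q \<in> N \<Longrightarrow> HX Q a (h q) = 0"
  shows "commutation_conditions Q (rewire Q
    (relabel (Inr ` N) (\<lambda>k. Inr (h (projr k)))) (relabel (Inl ` M) (\<lambda>k. Inl (h0 (projl k)))) g)"
    (is "commutation_conditions Q (rewire Q (relabel ?D ?f) (relabel ?DC ?fC) g)")
proof -
  let ?g = "rewire Q (relabel ?D ?f) (relabel ?DC ?fC) g"
  have phi1: "Phi1 ?g k v = mat_vec (qubits Q <+> qubits Q) (relabel ?D ?f) (\<lambda>k. Phi1 g k v) k"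
    and phi0: "Phi0 ?g c e = mat_vec (xchecks Q <+> zchecks Q) (relabel ?DC ?fC) (\<lambda>c. Phi0 g c e) c"
    for k v c e
    by (simp_all add: rewire_def mat_mul_eq_mat_vec)
  have inj: "inj_on ?f ?D" "inj_on ?fC ?DC"
    using N(2) M(2) by (auto simp: inj_on_def)
  \<comment> \<open>The relabelings land in Z-rows and in X-check rows, so the X-halves vanish and
    only the condition for \<open>HX\<close> is left.\<close>
  have X0': "Phi1X ?g = 0" "Phi0X ?g = 0"
    unfolding Phi1X_def Phi0X_def fun_eq_iff phi1 phi0
    by (auto intro!: mat_vec_relabel_eq_0)
  have "mat_mul (qubits Q) (HX Q) (Phi1Z ?g) = mat_mul (edges (graph g)) (Phi0Z ?g) (bd1 (graph g))"
  proof (rule mat_mul_transport[where P = "Phi1Z g" and F = "Phi0Z g", OF fin(1) N])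
    show "mat_mul (qubits Q) (HX Q) (Phi1Z g) = mat_mul (edges (graph g)) (Phi0Z g) (bd1 (graph g))"
      using cc by (simp add: commutation_conditions_def)
    show "Phi1Z ?g (h q) = Phi1Z g q" if "q \<in> N" for q
      using mat_vec_relabel_image[OF _ _ inj(1), of "qubits Q <+> qubits Q" "Inr q"] that N(1) fin
      unfolding Phi1Z_def fun_eq_iff phi1 by (auto simp: finite_Plus)
    show "Phi1Z ?g q v = 0" if "q \<notin> h ` N" for q v
      unfolding Phi1Z_def phi1 using that by (intro mat_vec_relabel_eq_0) auto
    show "Phi0Z ?g (h0 a) = Phi0Z g a" if "a \<in> M" for a
      using mat_vec_relabel_image[OF _ _ inj(2), of "xchecks Q <+> zchecks Q" "Inl a"] that M(1) fin
      unfolding Phi0Z_def fun_eq_iff phi0 by (auto simp: finite_Plus)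
    show "Phi0Z ?g a e = 0" if "a \<notin> h0 ` M" for a e
      unfolding Phi0Z_def phi0 using that by (intro mat_vec_relabel_eq_0) auto
  qed (use H N0 in \<open>auto simp: Phi1Z_def\<close>)
  moreover have "graph ?g = graph g" by (simp add: rewire_def)
  ultimately show ?thesis
    unfolding commutation_conditions_def X0' by (simp add: mat_mul_def transp_def fun_eq_iff)
qed

text \<open>The Z-half of the gadget becomes an X-half and Z-checks take the place of X-checks, so
  the old condition for \<open>HX\<close> yields the new one for \<open>HZ\<close>.\<close>

lemma commutation_rewire_Z_to_X:
  assumes fin: "finite (qubits Q)" "finite (xchecks Q)" "finite (zchecks Q)"
    and cc: "commutation_conditions Q g"
    and X0: "\<And>q v. Phi1 g (Inl q) v = 0" and N0: "\<And>q v. q \<notin> N \<Longrightarrow> Phi1 g (Inr q) v = 0"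
    and N: "N \<subseteq> qubits Q" "inj_on h N" "h ` N \<subseteq> qubits Q"
    and M: "M \<subseteq> xchecks Q" "inj_on h0 M"
    and H: "\<And>a q. a \<in> M \<Longrightarrow> q \<in> N \<Longrightarrow> HZ Q (h0 a) (h q) = HX Q a q"
      "\<And>b q. b \<notin> h0 ` M \<Longrightarrow> q \<in> N \<Longrightarrow> HZ Q b (h q) = 0"
  shows "commutation_conditions Q (rewire Q
    (relabel (Inr ` N) (\<lambda>k. Inl (h (projr k)))) (relabel (Inl ` M) (\<lambda>k. Inr (h0 (projl k)))) g)"
    (is "commutation_conditions Q (rewire Q (relabel ?D ?f) (relabel ?DC ?fC) g)")
proof -
  let ?g = "rewire Q (relabel ?D ?f) (relabel ?DC ?fC) g"
  have phi1: "Phi1 ?g k v = mat_vec (qubits Q <+> qubits Q) (relabel ?D ?f) (\<lambda>k. Phi1 g k v) k"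
    and phi0: "Phi0 ?g c e = mat_vec (xchecks Q <+> zchecks Q) (relabel ?DC ?fC) (\<lambda>c. Phi0 g c e) c"
    for k v c e
    by (simp_all add: rewire_def mat_mul_eq_mat_vec)
  have inj: "inj_on ?f ?D" "inj_on ?fC ?DC"
    using N(2) M(2) by (auto simp: inj_on_def)
  have Z0': "Phi1Z ?g = 0" "Phi0Z ?g = 0"
    unfolding Phi1Z_def Phi0Z_def fun_eq_iff phi1 phi0
    by (auto intro!: mat_vec_relabel_eq_0)
  have "mat_mul (qubits Q) (HZ Q) (Phi1X ?g) = mat_mul (edges (graph g)) (Phi0X ?g) (bd1 (graph g))"
  proof (rule mat_mul_transport[where P = "Phi1Z g" and F = "Phi0Z g", OF fin(1) N])
    show "mat_mul (qubits Q) (HX Q) (Phi1Z g) = mat_mul (edges (graph g)) (Phi0Z g) (bd1 (graph g))"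
      using cc by (simp add: commutation_conditions_def)
    show "Phi1X ?g (h q) = Phi1Z g q" if "q \<in> N" for q
      using mat_vec_relabel_image[OF _ _ inj(1), of "qubits Q <+> qubits Q" "Inr q"] that N(1) fin
      unfolding Phi1Z_def Phi1X_def fun_eq_iff phi1 by (auto simp: finite_Plus)
    show "Phi1X ?g q v = 0" if "q \<notin> h ` N" for q v
      unfolding Phi1X_def phi1 using that by (intro mat_vec_relabel_eq_0) auto
    show "Phi0X ?g (h0 a) = Phi0Z g a" if "a \<in> M" for a
      using mat_vec_relabel_image[OF _ _ inj(2), of "xchecks Q <+> zchecks Q" "Inl a"] that M(1) fin
      unfolding Phi0Z_def Phi0X_def fun_eq_iff phi0 by (auto simp: finite_Plus)
    show "Phi0X ?g a e = 0" if "a \<notin> h0 ` M" for a e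
      unfolding Phi0X_def phi0 using that by (intro mat_vec_relabel_eq_0) auto
  qed (use H N0 in \<open>auto simp: Phi1Z_def\<close>)
  moreover have "graph ?g = graph g" by (simp add: rewire_def)
  ultimately show ?thesis
    unfolding commutation_conditions_def Z0' by (simp add: mat_mul_def transp_def fun_eq_iff)
qed

section \<open>Cyclic shifts of coefficients\<close>

lemma degree_xl1: "l \<ge> 1 \<Longrightarrow> degree (xl1 l) = l"
  unfolding xl1_def by (subst degree_add_eq_left) (simp_all add: degree_monom_eq)

text \<open>Multiplication by x rotates the coefficients in \<open>R\<close> by one place, which is
  the induction step.\<close>

lemma coeff_shift_mod_xl1:
  assumes "l \<ge> 1" "c < l"
  shows "coeff ((monom 1 k * f) mod xl1 l) ((c + k) mod l) = coeff (f mod xl1 l) c"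
proof (induction k)
  case (Suc k)
  define r where "r = (monom 1 k * f) mod xl1 l"
  \<comment> \<open>The reduced form of x times \<open>r\<close>: subtracting the overflow
    coefficient times \<open>xl1 l\<close> clears degree \<open>l\<close> and, in characteristic
    two, puts that coefficient into degree 0.\<close>
  define s where "s = pCons 0 r - smult (coeff r (l - 1)) (xl1 l)"
  have deg: "degree r < l"
    using degree_mod_less'[of "xl1 l" "monom 1 k * f"] assms(1) degree_xl1[OF assms(1)]
    by (cases "r = 0"; cases "xl1 l = 0") (auto simp: r_def)
  have cs: "coeff s e = (if e = 0 then 0 else coeff r (e - 1)) - coeff r (l - 1) *
      ((if e = l then 1 else 0) + (if e = 0 then 1 else 0))" for e
    by (simp add: s_def xl1_def coeff_pCons split: nat.split)
  have "degree s < l"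
  proof -
    have "coeff s e = 0" if "e \<ge> l" for e
      using that assms(1) coeff_eq_0[of r "e - 1"] deg by (auto simp: cs)
    then have "degree s \<le> l - 1" using assms(1) by (intro degree_le) auto
    then show ?thesis using assms(1) by linarith
  qed
  then have "s = s mod xl1 l"
    using degree_xl1[OF assms(1)] by (simp add: mod_poly_less)
  also have "s mod xl1 l = pCons 0 r mod xl1 l"
    by (simp add: s_def mod_eq_dvd_iff dvd_smult)
  also have "pCons 0 r = monom 1 1 * r"
    by (simp add: monom_Suc)
  also have "(monom 1 1 * r) mod xl1 l = (monom 1 (Suc k) * f) mod xl1 l"
    unfolding r_def mod_mult_right_eq by (simp add: mult_monom flip: mult.assoc)
  finally have s: "(monom 1 (Suc k) * f) mod xl1 l = s" by simp
  define e where "e = (c + k) mod l"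
  have "e < l" using assms by (simp add: e_def)
  have "(c + Suc k) mod l = (if e = l - 1 then 0 else Suc e)"
    using assms(1) by (auto simp: e_def mod_Suc)
  then have "coeff s ((c + Suc k) mod l) = coeff r e"
    using \<open>e < l\<close> by (auto simp: cs)
  then show ?case
    using Suc by (simp add: s r_def e_def)
qed (use assms in simp)

text \<open>In \<open>R\<close> the \<open>l\<close>-th power of x is 1, as it equals
  \<open>xl1 l + 1\<close> in characteristic two.\<close>

lemma monom_mod_xl1: "monom 1 e mod xl1 l = monom 1 (e mod l) mod xl1 l"
proof -
  have "(1 :: bit poly) + 1 = 0"
    unfolding one_pCons by (simp only: add_pCons bit_add_self add_0 pCons_0_0)
  then have "monom 1 l = xl1 l + 1"
    by (simp only: xl1_def add.assoc add_0_right)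
  then have x: "monom 1 l mod xl1 l = 1 mod xl1 l" by simp
  have "monom 1 e = monom 1 l ^ (e div l) * (monom 1 (e mod l) :: bit poly)"
    by (simp add: monom_power mult_monom)
  also have "\<dots> mod xl1 l = ((monom 1 l mod xl1 l) ^ (e div l) * monom 1 (e mod l)) mod xl1 l"
    by (metis mod_mult_left_eq power_mod)
  also have "\<dots> = monom 1 (e mod l) mod xl1 l"
    unfolding x by (metis mod_mult_left_eq mult_1 power_mod power_one)
  finally show ?thesis .
qed

text \<open>Multiplication in \<open>R\<close> has a circulant matrix. Hence incidences of qubits
  and checks survive a simultaneous shift of their exponents.\<close>

lemma circulant_shift:
  assumes "l \<ge> 1" "a < l"
  shows "coeff ((f * monom 1 ((b + k) mod l)) mod xl1 l) ((a + k) mod l) =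
    coeff ((f * monom 1 b) mod xl1 l) a"
proof -
  have "(f * monom 1 ((b + k) mod l)) mod xl1 l = (f * monom 1 (b + k)) mod xl1 l"
    by (metis mod_mult_right_eq monom_mod_xl1)
  also have "f * monom 1 (b + k) = monom 1 k * (f * monom 1 b)"
    by (simp add: mult_monom mult.left_commute add.commute)
  finally show ?thesis using coeff_shift_mod_xl1[OF assms] by simp
qed

section \<open>Moving the seeds of a lifted-product code\<close>

lemma cyclic_shift_eq_iff:
  "k < l \<Longrightarrow> c < l \<Longrightarrow> c' < l \<Longrightarrow> (c + k) mod l = (c' + k) mod l \<longleftrightarrow> c = c'"
  for k l :: nat
  by (auto simp: mod_if split: if_splits)

lemma cyclic_shift_surj:
  fixes k l :: nat
  assumes "k < l" "c < l"
  obtains c' where "c' < l" "c = (c' + k) mod l"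
proof (cases "k \<le> c")
  case True
  then show thesis using assms by (intro that[of "c - k"]) auto
next
  case False
  then show thesis using assms by (intro that[of "c + l - k"]) auto
qed

lemma HX_LP_left:
  "HX (LP l m n A) ((a, b), c) (Inl (a', b'), c') =
    (if c < l \<and> c' < l then coeff ((A a a' * id_mat n b b' * monom 1 c') mod xl1 l) c else 0)"
  by (simp add: LP_def bin_mat_def append_blocks_def kron_def)

text \<open>The indices are named with the tensor factors exchanged, so that the right-hand side is
  literally that of \<open>HX_LP_left\<close>.\<close>

lemma HZ_LP_left:
  "HZ (LP l m n A) ((b, a), c) (Inl (b', a'), c') =
    (if c < l \<and> c' < l then coeff ((A a a' * id_mat n b b' * monom 1 c') mod xl1 l) c else 0)"
  by (simp add: LP_def bin_mat_def append_blocks_def kron_def mult.commute mult.left_commute)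

lemma supp_Zbar_eq:
  "supp_Zbar l m n G i j k (Inl (a, b), c) =
    (if b = j \<and> c < l then coeff ((monom 1 k * u_row m n G i a) mod xl1 l) c else 0)"
  "supp_Zbar l m n G i j k (Inr x, c) = 0"
  by (simp_all add: supp_Zbar_def left_block_tensor_def bin_vec_def unit_row_def)

lemma supp_Xbar_eq:
  "supp_Xbar l m n G i j k (Inl (a, b), c) =
    (if a = i \<and> c < l then coeff ((monom 1 k * u_row m n G j b) mod xl1 l) c else 0)"
  "supp_Xbar l m n G i j k (Inr x, c) = 0"
  by (simp_all add: supp_Xbar_def left_block_tensor_def bin_vec_def unit_row_def)

lemma u_row_eq_0: "m \<le> n \<Longrightarrow> a \<ge> n \<Longrightarrow> u_row m n G i a = 0"
  by (simp add: u_row_def)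

text \<open>One set for all seeds: it contains the support of every
  \<open>Zbar l m n G i 0 0\<close>.\<close>

definition seed_column :: "nat \<Rightarrow> nat \<Rightarrow> lp_qubit set" where
  "seed_column l n = (\<lambda>(a, c). (Inl (a, 0), c)) ` ({..<n} \<times> {..<l})"

text \<open>The X-checks that can meet \<open>seed_column\<close>: the identity factor of
  \<open>HX\<close> forces the second index 0.\<close>

definition seed_xchecks :: "nat \<Rightarrow> nat \<Rightarrow> lp_check set" where
  "seed_xchecks l m = (\<lambda>(a, c). ((a, 0), c)) ` ({..<m} \<times> {..<l})"

text \<open>One formula serves left-block qubits and check labels. The second index is overwritten,
  so injectivity is claimed on the seed sets only.\<close>

definition move_along_column :: "nat \<Rightarrow> nat \<Rightarrow> nat \<Rightarrow> (nat \<times> nat) \<times> nat \<Rightarrow> (nat \<times> nat) \<times> nat" where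
  "move_along_column l j k = (\<lambda>((a, b), c). ((a, j), (c + k) mod l))"

text \<open>Exchanging the two tensor factors interchanges \<open>H\<^sub>X\<close> and \<open>H\<^sub>Z\<close>, which is how Z-seeds
  yield X-operators.\<close>

definition move_to_row :: "nat \<Rightarrow> nat \<Rightarrow> nat \<Rightarrow> (nat \<times> nat) \<times> nat \<Rightarrow> (nat \<times> nat) \<times> nat" where
  "move_to_row l i k = (\<lambda>((a, b), c). ((i, a), (c + k) mod l))"

text \<open>\<open>projl\<close> is unspecified on the right block, but the map is only used on
  \<open>seed_column\<close>.\<close>

definition on_left_block :: "((nat \<times> nat) \<times> nat \<Rightarrow> (nat \<times> nat) \<times> nat) \<Rightarrow> lp_qubit \<Rightarrow> lp_qubit" where
  "on_left_block f = (\<lambda>(s, c). case f (projl s, c) of (s', c') \<Rightarrow> (Inl s', c'))"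

lemmas moves_def =
  seed_column_def seed_xchecks_def move_along_column_def move_to_row_def on_left_block_def

lemma moves_inj:
  assumes "k < l"
  shows "inj_on (on_left_block (move_along_column l j k)) (seed_column l n)"
    "inj_on (on_left_block (move_to_row l j k)) (seed_column l n)"
    "inj_on (move_along_column l j k) (seed_xchecks l m)"
    "inj_on (move_to_row l j k) (seed_xchecks l m)"
  by (auto simp: moves_def inj_on_def cyclic_shift_eq_iff[OF assms])

lemma LP_finite: "finite (qubits (LP l m n A))" "finite (xchecks (LP l m n A))"
    "finite (zchecks (LP l m n A))"
  by (auto simp: LP_def)

section \<open>Transport of the gadget of one fixed seed\<close>

context
  fixes l m n d \<delta> :: nat and A G :: "nat \<Rightarrow> nat \<Rightarrow> bit poly" and i0 :: nat
    and g :: "(lp_qubit, lp_check, lp_check, 'v, 'e) gadget" and k :: nat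
  assumes l: "l \<ge> 1" and mn: "m \<le> n" and n: "n > 0" and A: "A \<in> R_mat l m n"
    and dist: "distance (css_stabilizer_code (LP l m n A)) \<ge> enat d"
    and g: "gadget_on (LP l m n A) g" and des: "desiderata (LP l m n A) d \<delta> (Zbar l m n G i0 0 0) g"
    and k: "k < l"
begin

text \<open>Elementarity makes the rows of \<open>Phi1\<close> vanish off the support of the
  measured operator, and a seed is of Z-type with support in \<open>seed_column\<close>.\<close>

lemma seed_Phi1:
  shows "Phi1 g (Inl q) v = 0" "q \<notin> seed_column l n \<Longrightarrow> Phi1 g (Inr q) v = 0"
proof -
  have el: "elementary g (Zbar l m n G i0 0 0)" using des by (simp add: desiderata_def)
  then have z: "Phi1 g k v = 0" if "Zbar l m n G i0 0 0 k = 0" for k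
  proof -
    have "Phi1 g k = 0" using el that unfolding elementary_def by blast
    then show ?thesis by simp
  qed
  show "Phi1 g (Inl q) v = 0" by (rule z) (simp add: Zbar_def z_pauli_def)
  show "Phi1 g (Inr q) v = 0" if "q \<notin> seed_column l n"
  proof (rule z)
    obtain s c where q: "q = (s, c)" by fastforce
    have "supp_Zbar l m n G i0 0 0 q = 0"
    proof (cases s)
      case (Inl ab)
      then show ?thesis
        using that u_row_eq_0[OF mn, of "fst ab" G i0] unfolding q
        by (cases ab) (force simp: supp_Zbar_eq seed_column_def)
    qed (simp add: q supp_Zbar_eq)
    then show "Zbar l m n G i0 0 0 (Inr q) = 0" by (simp add: Zbar_def z_pauli_def)
  qed
qed

text \<open>As there is no X-part, the full weight of a column is that of its Z-half.\<close>

lemma seed_column_weight: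
  assumes "v \<in> verts (graph g)" "\<rho> \<ge> real (max (max_col_weight (verts (graph g)) (Phi1X g))
    (max_col_weight (verts (graph g)) (Phi1Z g)))"
  shows "real (hamming (\<lambda>k. Phi1 g k v)) \<le> \<rho>"
proof -
  have "{k. Phi1 g k v \<noteq> 0} = Inr ` {q. Phi1 g (Inr q) v \<noteq> 0}"
  proof (intro set_eqI)
    fix k show "k \<in> {k. Phi1 g k v \<noteq> 0} \<longleftrightarrow> k \<in> Inr ` {q. Phi1 g (Inr q) v \<noteq> 0}"
      by (cases k) (auto simp: seed_Phi1(1))
  qed
  then have "hamming (\<lambda>k. Phi1 g k v) = hamming (\<lambda>q. Phi1Z g q v)"
    by (simp add: hamming_def Phi1Z_def card_image)
  also have "\<dots> \<le> max_col_weight (verts (graph g)) (Phi1Z g)"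
    unfolding max_col_weight_def using assms(1) g
    by (intro Max_ge) (auto simp: gadget_on_def valid_graph_def)
  finally show ?thesis using assms(2) by simp
qed

text \<open>Gathers what does not depend on the target; for each basis operator there remain the
  transforming map, its commutation conditions and the image of the seed.\<close>

lemma seed_rewired_fault_tolerant:
  assumes T: "(relabel D f, T0) \<in> transforming_maps (LP l m n A)"
    and cc: "commutation_conditions (LP l m n A) (rewire (LP l m n A) (relabel D f) T0 g)"
  shows "fault_tolerantly_measures (LP l m n A) d (rewire (LP l m n A) (relabel D f) T0 g)
    (mat_vec (qubits (LP l m n A) <+> qubits (LP l m n A)) (relabel D f) (Zbar l m n G i0 0 0))"
proof -
  obtain \<rho> where rho: "sound (graph g) d \<rho>"
    "\<rho> \<ge> real (max (max_col_weight (verts (graph g)) (Phi1X g))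
      (max_col_weight (verts (graph g)) (Phi1Z g)))"
    using des by (auto simp: desiderata_def)
  show ?thesis
  proof (rule rewire_relabel_fault_tolerant[OF LP_finite g T cc _ rho(1) _ dist])
    show "measured_operators g = {0, Zbar l m n G i0 0 0}"
      using des by (simp add: desiderata_def)
  qed (rule seed_column_weight[OF _ rho(2)])
qed

lemma seed_commutation: "commutation_conditions (LP l m n A) g"
  using des by (simp add: desiderata_def)

lemma seed_column_subset: "seed_column l n \<subseteq> qubits (LP l m n A)"
  using n by (auto simp: LP_def seed_column_def)

lemma seed_xchecks_subset: "seed_xchecks l m \<subseteq> xchecks (LP l m n A)"
  using n by (auto simp: LP_def seed_xchecks_def)

lemma A_outside: "a \<ge> m \<Longrightarrow> A a a' = 0"
  using A by (auto simp: R_mat_def mat_on_def)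

text \<open>Shows that \<open>A\<close> contributes zero at the checks of column \<open>j\<close>
  missed by the move; every other check there has a preimage, found by undoing the cyclic
  shift.\<close>

lemma xcheck_in_move_along_column:
  "((a, b), c) \<notin> move_along_column l j k ` seed_xchecks l m \<Longrightarrow> c < l \<Longrightarrow> b = j \<Longrightarrow> a \<ge> m"
  by (rule ccontr, rule cyclic_shift_surj[OF k, of c])
     (force simp: move_along_column_def seed_xchecks_def)+

lemma zcheck_in_move_to_row:
  "((b, a), c) \<notin> move_to_row l i k ` seed_xchecks l m \<Longrightarrow> c < l \<Longrightarrow> b = i \<Longrightarrow> a \<ge> m"
  by (rule ccontr, rule cyclic_shift_surj[OF k, of c])
     (force simp: move_to_row_def seed_xchecks_def)+

lemma qubit_in_move_along_column:
  "(Inl (a, b), c) \<notin> on_left_block (move_along_column l j k) ` seed_column l n \<Longrightarrow>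
    c < l \<Longrightarrow> b = j \<Longrightarrow> a \<ge> n"
  by (rule ccontr, rule cyclic_shift_surj[OF k, of c])
     (force simp: on_left_block_def move_along_column_def seed_column_def)+

lemma qubit_in_move_to_row:
  "(Inl (b, a), c) \<notin> on_left_block (move_to_row l i k) ` seed_column l n \<Longrightarrow>
    c < l \<Longrightarrow> b = i \<Longrightarrow> a \<ge> n"
  by (rule ccontr, rule cyclic_shift_surj[OF k, of c])
     (force simp: on_left_block_def move_to_row_def seed_column_def)+

text \<open>The X-checks \<open>(a, 0)\<close> move to \<open>(a, j)\<close> together with the
  qubits. The identity factor is 1 before and after and the entries of \<open>A\<close> act as
  circulants, so incidences are kept; the shift multiplies the seed by the \<open>k\<close>-th power
  of x.\<close>

lemma seed_to_Zbar:
  assumes j: "j < n"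
  shows "\<exists>(T1, T0) \<in> transforming_maps (LP l m n A).
    Zbar l m n G i0 j k = mat_vec (qubits (LP l m n A) <+> qubits (LP l m n A)) T1 (Zbar l m n G i0 0 0) \<and>
    fault_tolerantly_measures (LP l m n A) d (rewire (LP l m n A) T1 T0 g) (Zbar l m n G i0 j k)"
proof -
  let ?N = "seed_column l n" and ?M = "seed_xchecks l m"
  let ?h = "on_left_block (move_along_column l j k)" and ?hc = "move_along_column l j k"
  let ?f = "\<lambda>q :: lp_qubit + lp_qubit. Inr (?h (projr q)) :: lp_qubit + lp_qubit"
  let ?fc = "\<lambda>c :: lp_check + lp_check. Inl (?hc (projl c)) :: lp_check + lp_check"
  let ?T1 = "relabel (Inr ` ?N) ?f" and ?TC = "relabel (Inl ` ?M) ?fc"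
  let ?J = "qubits (LP l m n A) <+> qubits (LP l m n A)"
  have hN: "?h ` ?N \<subseteq> qubits (LP l m n A)" and hM: "?hc ` ?M \<subseteq> xchecks (LP l m n A)"
    using j l by (auto simp: LP_def moves_def)
  have T: "(?T1, ?TC) \<in> transforming_maps (LP l m n A)"
    using hN hM seed_column_subset seed_xchecks_subset
    by (auto simp: transforming_maps_def intro!: relabel_mat_on)
  have cc: "commutation_conditions (LP l m n A) (rewire (LP l m n A) ?T1 ?TC g)"
  proof (rule commutation_rewire_Z_to_Z[OF LP_finite seed_commutation seed_Phi1
        seed_column_subset moves_inj(1)[OF k] hN seed_xchecks_subset moves_inj(3)[OF k]])
    show "HX (LP l m n A) (?hc a) (?h q) = HX (LP l m n A) a q" if "a \<in> ?M" "q \<in> ?N" for a q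
      using that j n l by (auto simp: moves_def HX_LP_left id_mat_def circulant_shift)
    \<comment> \<open>Zero comes from the identity factor, from a row beyond those of
      \<open>A\<close>, or from an exponent out of range.\<close>
    show "HX (LP l m n A) a (?h q) = 0" if "a \<notin> ?hc ` ?M" "q \<in> ?N" for a q
    proof -
      obtain a1 b c where a: "a = ((a1, b), c)" by (metis surj_pair)
      have "b \<noteq> j \<or> A a1 a' = 0 \<or> c \<ge> l" for a'
        using xcheck_in_move_along_column[OF that(1)[unfolded a]] A_outside by force
      then show ?thesis
        using that(2) unfolding a
        by (fastforce simp: seed_column_def on_left_block_def move_along_column_def HX_LP_left id_mat_def)
    qed
  qed
  \<comment> \<open>On the image of the move this is the rotation of coefficients by
    \<open>k\<close>; off the image both sides vanish.\<close>
  have "Zbar l m n G i0 j k = mat_vec ?J ?T1 (Zbar l m n G i0 0 0)"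
  proof
    fix x
    show "Zbar l m n G i0 j k x = mat_vec ?J ?T1 (Zbar l m n G i0 0 0) x"
    proof (cases "x \<in> ?f ` Inr ` ?N")
      case True
      then obtain q where q: "q \<in> ?N" "x = ?f (Inr q)" by blast
      have "mat_vec ?J ?T1 (Zbar l m n G i0 0 0) x = Zbar l m n G i0 0 0 (Inr q)"
        unfolding q(2) using q(1) seed_column_subset LP_finite(1) moves_inj(1)[OF k]
        by (intro mat_vec_relabel_image) (auto simp: inj_on_def)
      also have "\<dots> = Zbar l m n G i0 j k x"
        using q l coeff_shift_mod_xl1[of l _ k]
        by (auto simp: Zbar_def z_pauli_def supp_Zbar_eq seed_column_def on_left_block_def
            move_along_column_def)
      finally show ?thesis by simp
    next
      case False
      then have "mat_vec ?J ?T1 (Zbar l m n G i0 0 0) x = 0"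
        by (intro mat_vec_relabel_eq_0) auto
      moreover have "Zbar l m n G i0 j k x = 0"
      proof (cases x)
        case (Inr q)
        obtain s c where q: "q = (s, c)" by fastforce
        show ?thesis
        proof (cases s)
          case (Inl ab)
          obtain a b where ab: "ab = (a, b)" by fastforce
          have "q \<notin> ?h ` ?N" using False \<open>x = Inr q\<close> by force
          then have "b \<noteq> j \<or> c \<ge> l \<or> a \<ge> n"
            using qubit_in_move_along_column unfolding q Inl ab by force
          then show ?thesis
            using u_row_eq_0[OF mn] by (auto simp: \<open>x = Inr q\<close> q Inl ab Zbar_def z_pauli_def supp_Zbar_eq)
        qed (simp add: \<open>x = Inr q\<close> q Zbar_def z_pauli_def supp_Zbar_eq)
      qed (simp add: Zbar_def z_pauli_def)
      ultimately show ?thesis by simp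
    qed
  qed
  with seed_rewired_fault_tolerant[OF T cc] T show ?thesis
    by (intro bexI[OF _ T]) simp
qed

text \<open>Exchanging the tensor factors turns \<open>u \<otimes> e\<close> into
  \<open>e \<otimes> u\<close>, so the seed index \<open>i0\<close> becomes the second index of the
  X-operator, while the row \<open>i\<close> can be chosen.\<close>

lemma seed_to_Xbar:
  assumes i: "i < n"
  shows "\<exists>(T1, T0) \<in> transforming_maps (LP l m n A).
    Xbar l m n G i i0 k = mat_vec (qubits (LP l m n A) <+> qubits (LP l m n A)) T1 (Zbar l m n G i0 0 0) \<and>
    fault_tolerantly_measures (LP l m n A) d (rewire (LP l m n A) T1 T0 g) (Xbar l m n G i i0 k)"
proof -
  let ?N = "seed_column l n" and ?M = "seed_xchecks l m"
  let ?h = "on_left_block (move_to_row l i k)" and ?hc = "move_to_row l i k"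
  let ?f = "\<lambda>q :: lp_qubit + lp_qubit. Inl (?h (projr q)) :: lp_qubit + lp_qubit"
  let ?fc = "\<lambda>c :: lp_check + lp_check. Inr (?hc (projl c)) :: lp_check + lp_check"
  let ?T1 = "relabel (Inr ` ?N) ?f" and ?TC = "relabel (Inl ` ?M) ?fc"
  let ?J = "qubits (LP l m n A) <+> qubits (LP l m n A)"
  have hN: "?h ` ?N \<subseteq> qubits (LP l m n A)" and hM: "?hc ` ?M \<subseteq> zchecks (LP l m n A)"
    using i l by (auto simp: LP_def moves_def)
  have T: "(?T1, ?TC) \<in> transforming_maps (LP l m n A)"
    using hN hM seed_column_subset seed_xchecks_subset
    by (auto simp: transforming_maps_def intro!: relabel_mat_on)
  have cc: "commutation_conditions (LP l m n A) (rewire (LP l m n A) ?T1 ?TC g)"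
  proof (rule commutation_rewire_Z_to_X[OF LP_finite seed_commutation seed_Phi1
        seed_column_subset moves_inj(2)[OF k] hN seed_xchecks_subset moves_inj(4)[OF k]])
    \<comment> \<open>\<open>HZ\<close> sees row \<open>i\<close> through \<open>A\<close> just as
      \<open>HX\<close> sees column 0; the two entry formulas match.\<close>
    show "HZ (LP l m n A) (?hc a) (?h q) = HX (LP l m n A) a q" if "a \<in> ?M" "q \<in> ?N" for a q
      using that i n l by (auto simp: moves_def HX_LP_left HZ_LP_left id_mat_def circulant_shift)
    show "HZ (LP l m n A) a (?h q) = 0" if "a \<notin> ?hc ` ?M" "q \<in> ?N" for a q
    proof -
      obtain a1 b c where a: "a = ((b, a1), c)" by (metis surj_pair)
      have "b \<noteq> i \<or> A a1 a' = 0 \<or> c \<ge> l" for a'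
        using zcheck_in_move_to_row[OF that(1)[unfolded a]] A_outside by force
      then show ?thesis
        using that(2) unfolding a
        by (fastforce simp: seed_column_def on_left_block_def move_to_row_def HZ_LP_left id_mat_def)
    qed
  qed
  have "Xbar l m n G i i0 k = mat_vec ?J ?T1 (Zbar l m n G i0 0 0)"
  proof
    fix x
    show "Xbar l m n G i i0 k x = mat_vec ?J ?T1 (Zbar l m n G i0 0 0) x"
    proof (cases "x \<in> ?f ` Inr ` ?N")
      case True
      then obtain q where q: "q \<in> ?N" "x = ?f (Inr q)" by blast
      have "mat_vec ?J ?T1 (Zbar l m n G i0 0 0) x = Zbar l m n G i0 0 0 (Inr q)"
        unfolding q(2) using q(1) seed_column_subset LP_finite(1) moves_inj(2)[OF k]
        by (intro mat_vec_relabel_image) (auto simp: inj_on_def)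
      also have "\<dots> = Xbar l m n G i i0 k x"
        using q l coeff_shift_mod_xl1[of l _ k]
        by (auto simp: Zbar_def Xbar_def z_pauli_def x_pauli_def supp_Zbar_eq supp_Xbar_eq
            seed_column_def on_left_block_def move_to_row_def)
      finally show ?thesis by simp
    next
      case False
      then have "mat_vec ?J ?T1 (Zbar l m n G i0 0 0) x = 0"
        by (intro mat_vec_relabel_eq_0) auto
      moreover have "Xbar l m n G i i0 k x = 0"
      proof (cases x)
        case (Inl q)
        obtain s c where q: "q = (s, c)" by fastforce
        show ?thesis
        proof (cases s)
          case (Inl ab)
          obtain b a where ab: "ab = (b, a)" by fastforce
          have "q \<notin> ?h ` ?N" using False \<open>x = Inl q\<close> by force
          then have "b \<noteq> i \<or> c \<ge> l \<or> a \<ge> n"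
            using qubit_in_move_to_row unfolding q Inl ab by force
          then show ?thesis
            using u_row_eq_0[OF mn] by (auto simp: \<open>x = Inl q\<close> q Inl ab Xbar_def x_pauli_def supp_Xbar_eq)
        qed (simp add: \<open>x = Inl q\<close> q Xbar_def x_pauli_def supp_Xbar_eq)
      qed (simp add: Xbar_def x_pauli_def)
      ultimately show ?thesis by simp
    qed
  qed
  with seed_rewired_fault_tolerant[OF T cc] T show ?thesis
    by (intro bexI[OF _ T]) simp
qed

end

theorem theorem4:
  fixes l m n d \<delta> :: nat
    and A G :: "nat \<Rightarrow> nat \<Rightarrow> bit poly"
    and \<S> :: "lp_qubit pauli \<Rightarrow> (lp_qubit, lp_check, lp_check, 'v, 'e) gadget"
  assumes "l \<ge> 1" and "m \<le> n" and "A \<in> R_mat l m n"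
    and "canonical_LP l m n A G"
    and "distance (css_stabilizer_code (LP l m n A)) = enat d"
    and "\<forall>Ls \<in> seed_operators l m n G.
           gadget_on (LP l m n A) (\<S> Ls) \<and> desiderata (LP l m n A) d \<delta> Ls (\<S> Ls)"
  shows "\<forall>L \<in> canonical_basis l m n G.
           \<exists>Ls \<in> seed_operators l m n G. \<exists>(T1, T0) \<in> transforming_maps (LP l m n A).
             L = mat_vec (qubits (LP l m n A) <+> qubits (LP l m n A)) T1 Ls \<and>
             fault_tolerantly_measures (LP l m n A) d (rewire (LP l m n A) T1 T0 (\<S> Ls)) L"
proof
  fix L assume "L \<in> canonical_basis l m n G"
  then obtain i j k where ijk: "i < n - m" "j < n - m" "k < l"
    and L: "L = Zbar l m n G i j k \<or> L = Xbar l m n G i j k"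
    by (auto simp: canonical_basis_def)
  have seed: "Zbar l m n G i' 0 0 \<in> seed_operators l m n G" if "i' < n - m" for i'
    using that by (auto simp: seed_operators_def)
  have n: "n > 0" "i < n" "j < n" using ijk by auto
  have dist: "distance (css_stabilizer_code (LP l m n A)) \<ge> enat d" using assms(5) by simp
  have g: "gadget_on (LP l m n A) (\<S> (Zbar l m n G i' 0 0))"
    "desiderata (LP l m n A) d \<delta> (Zbar l m n G i' 0 0) (\<S> (Zbar l m n G i' 0 0))"
    if "i' < n - m" for i'
    using assms(6) seed[OF that] by blast+
  from L show "\<exists>Ls \<in> seed_operators l m n G. \<exists>(T1, T0) \<in> transforming_maps (LP l m n A).
      L = mat_vec (qubits (LP l m n A) <+> qubits (LP l m n A)) T1 Ls \<and>
      fault_tolerantly_measures (LP l m n A) d (rewire (LP l m n A) T1 T0 (\<S> Ls)) L"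
  proof
    assume "L = Zbar l m n G i j k"
    then show ?thesis
      using seed_to_Zbar[OF assms(1,2) n(1) assms(3) dist g[OF ijk(1)] ijk(3) n(3)]
      by (intro bexI[OF _ seed[OF ijk(1)]]) simp
  next
    \<comment> \<open>The row of \<open>(I, G)\<close> in an X-operator is given by its second
      index, so the seed is taken at \<open>j\<close>, not at \<open>i\<close>.\<close>
    assume "L = Xbar l m n G i j k"
    then show ?thesis
      using seed_to_Xbar[OF assms(1,2) n(1) assms(3) dist g[OF ijk(2)] ijk(3) n(2)]
      by (intro bexI[OF _ seed[OF ijk(2)]]) simp
  qed
qed

end
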